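(* Let $z\in\mathbb{C}$ and let $\alpha,\beta>0$ with $\alpha\beta=1$. Then \begin{align*} &\sqrt{\alpha}\,e^{\frac{z^2}{8}}\left(\operatorname{erf}\left(\frac{z}{2}\right)-4\int_{0}^{\infty}\frac{e^{-\pi\alpha^2 x^2}\sin(\sqrt{\pi}\,\alpha xz)}{e^{2\pi x}-1}\, dx\right)\\ &=\sqrt{\beta}\,e^{-\frac{z^2}{8}}\left(\operatorname{erfi}\left(\frac{z}{2}\right)-4\int_{0}^{\infty}\frac{e^{-\pi\beta^2 x^2}\sinh(\sqrt{\pi}\,\beta xz)}{e^{2\pi x}-1}\, dx\right)\\ &=\frac{z}{8\pi^2}\int_{0}^{\infty}\Gamma\left(\frac{-1+it}{4}\right)\Gamma\left(\frac{-1-it}{4}\right)\Xi\left(\frac{t}{2}\right)\Delta\left(\alpha,z,\frac{1+it}{2}\right)\, dt. \end{align*}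
   Context: $\operatorname{erf}(z)=\frac{2}{\sqrt{\pi}}\int_0^z e^{-t^2}\,dt$ and $\operatorname{erfi}(z)=\frac{2}{\sqrt{\pi}}\int_0^z e^{t^2}\,dt$. $\Xi(t):=\xi(\tfrac12+it)$, where $\xi(s)=\frac12 s(s-1)\pi^{-s/2}\Gamma(s/2)\zeta(s)$ is Riemann's $\xi$-function. ${}_1F_1(a;c;w)$ denotes Kummer's confluent hypergeometric function. For $x>0$, $z,s\in\mathbb{C}$, $\omega(x,z,s):=x^{\frac12-s}e^{-\frac{z^2}{8}}\,{}_1F_1\left(1-\frac{s}{2};\frac32;\frac{z^2}{4}\right)$ and $\Delta(x,z,s):=\omega(x,z,s)+\omega(x,z,1-s)$. *)

theory Defs
  imports "HOL-Complex_Analysis.Complex_Analysis"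
begin

definition erf :: "complex \<Rightarrow> complex" where
  "erf z = 2 / of_real (sqrt pi) * contour_integral (linepath 0 z) (\<lambda>t. exp (- (t ^ 2)))"

definition erfi :: "complex \<Rightarrow> complex" where
  "erfi z = 2 / of_real (sqrt pi) * contour_integral (linepath 0 z) (\<lambda>t. exp (t ^ 2))"

(* Riemann zeta: the analytic continuation of the Dirichlet series to the plane punctured
   at 1. It is unique by the identity theorem; the value 0 at the pole is a convention. *)
definition riemann_zeta :: "complex \<Rightarrow> complex" where
  "riemann_zeta = (THE f. f holomorphic_on - {1} \<and> f 1 = 0 \<and>
     (\<forall>s. Re s > 1 \<longrightarrow> (\<lambda>n. 1 / of_nat (Suc n) powr s) sums f s))"

(* remove_sings fills in the removable singularities of the product at s = 1 and at
   s = 0, -2, -4, ..., where the library's Gamma and riemann_zeta above are set to 0 at poles. *)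
definition riemann_xi :: "complex \<Rightarrow> complex" where
  "riemann_xi = remove_sings
     (\<lambda>s. 1 / 2 * s * (s - 1) * of_real pi powr (- s / 2) * Gamma (s / 2) * riemann_zeta s)"

definition riemann_Xi :: "complex \<Rightarrow> complex" where
  "riemann_Xi t = riemann_xi (1 / 2 + \<i> * t)"

definition kummer_1F1 :: "complex \<Rightarrow> complex \<Rightarrow> complex \<Rightarrow> complex" where
  "kummer_1F1 a c w = eval_fps (fps_hypergeo [a] [c] 1) w"

definition omega :: "real \<Rightarrow> complex \<Rightarrow> complex \<Rightarrow> complex" where
  "omega x z s = of_real x powr (1 / 2 - s) * exp (- (z ^ 2) / 8)
     * kummer_1F1 (1 - s / 2) (3 / 2) (z ^ 2 / 4)"

definition Delta :: "real \<Rightarrow> complex \<Rightarrow> complex \<Rightarrow> complex" where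
  "Delta x z s = omega x z s + omega x z (1 - s)"

definition sin_integrand :: "real \<Rightarrow> complex \<Rightarrow> real \<Rightarrow> complex" where
  "sin_integrand a z x = of_real (exp (- pi * a ^ 2 * x ^ 2))
     * sin (of_real (sqrt pi * a * x) * z) / of_real (exp (2 * pi * x) - 1)"

definition sinh_integrand :: "real \<Rightarrow> complex \<Rightarrow> real \<Rightarrow> complex" where
  "sinh_integrand b z x = of_real (exp (- pi * b ^ 2 * x ^ 2))
     * sinh (of_real (sqrt pi * b * x) * z) / of_real (exp (2 * pi * x) - 1)"

definition Xi_integrand :: "real \<Rightarrow> complex \<Rightarrow> real \<Rightarrow> complex" where
  "Xi_integrand a z t = Gamma ((- 1 + \<i> * of_real t) / 4) * Gamma ((- 1 - \<i> * of_real t) / 4)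
     * riemann_Xi (of_real t / 2) * Delta a z ((1 + \<i> * of_real t) / 2)"

end

(*
Put phi(x) = 1 / (e^(2 pi x) - 1) - 1 / (2 pi x). The term 1 / (2 pi x) accounts exactly for erfi,
so the second expression is -4 sqrt(beta) e^(-z^2/8) times the integral of
e^(-pi beta^2 x^2) sinh(sqrt(pi) beta x z) phi(x). Integrating the sine series termwise, the Mellin
transform of the Gaussian factor is a Gamma function times a 1F1; the Mellin transform of phi at
1 - s is Gamma(s/2) Gamma(1 - s/2) zeta(s) / (2 pi). Parseval's formula on Re s = 1/2 (Fourier
inversion in u = log x) turns the second expression into the integral over Xi. By Kummer's
transformation that integral is multiplied by i when (alpha, z) is replaced by (1/alpha, i z), and
the same replacement turns the second expression into i times the first one.

Muentz' formula relates the Mellin transform of sum_n k(n x) - (1/x) int_0^oo k to the one of k by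
a factor zeta(s). For k(x) = e^(-2 pi x) the left-hand side is phi(x), and for k(x) = 1 / (1 + x^2)
it is (pi/x) phi(1/x), by the partial fractions of coth. Comparing the two gives the functional
equation in the critical strip, which glues zeta on Re s > 0 to its reflection on Re s < 1.
*)
theory Submission
  imports Defs "HOL-Probability.Probability"
begin

section \<open>Substitution, Gamma and Fourier integrals\<close>

text \<open>The obstacle is absolute convergence on the critical line without growth estimates for
  zeta. The two factors in Parseval's formula are therefore treated differently: inversion is
  applied to the Gaussian factor, whose transform on Re s = 1/2 is bounded by a multiple of
  \<open>1 / (1 + t^2)\<close>, while the transform of phi only needs the trivial bound by its
  absolutely convergent integral. That bound controls the product of Gamma values and zeta as a
  whole. Subtracting \<open>1 / (2 pi x)\<close> makes phi bounded at 0 at the price of decay like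
  1/x at infinity, so its Mellin transform converges for 0 < Re s < 1, and all of the analysis of
  phi takes place in this strip. There the series of zeta diverges; the kernels in Muentz' formula
  are nonnegative and decreasing, which makes the truncated expressions monotone in the number of
  terms and justifies the passage to the limit. With x = e^u, scaling becomes translation, and
  Mellin transforms become Lebesgue integrals over the whole line.\<close>

lemma range_exp_real: "range exp = {0::real<..}"
proof safe
  fix x :: real assume "x > 0"
  then have "x = exp (ln x)" by simp
  then show "x \<in> range exp" by blast
qed auto

text \<open>The way back from the variable \<open>u = ln x\<close>, in which all transforms are
  computed, to the integrals over \<open>{0<..}\<close> of the final statement.\<close>

lemma absolutely_integrable_exp_substitution:
  fixes f :: "real \<Rightarrow> complex"
  assumes "integrable lborel (\<lambda>u. of_real (exp u) * f (exp u))"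
  shows "f absolutely_integrable_on {0<..}"
    and "integral {0<..} f = (\<integral>u. of_real (exp u) * f (exp u) \<partial>lborel)"
proof -
  have "(\<lambda>u. \<bar>exp u\<bar> *\<^sub>R f (exp u)) absolutely_integrable_on UNIV"
    using assms by (simp add: set_integrable_def integrable_completion scaleR_conv_of_real)
  moreover have "integral UNIV (\<lambda>u. \<bar>exp u\<bar> *\<^sub>R f (exp u)) = (\<integral>u. of_real (exp u) * f (exp u) \<partial>lborel)"
    using integral_lborel[OF assms] by (simp add: scaleR_conv_of_real)
  ultimately have "f absolutely_integrable_on (exp ` UNIV) \<and>
      integral (exp ` UNIV) f = (\<integral>u. of_real (exp u) * f (exp u) \<partial>lborel)"
    by (subst has_absolute_integral_change_of_variables_real[where h = exp, symmetric])
       (auto intro!: derivative_eq_intros simp: inj_on_def)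
  then show "f absolutely_integrable_on {0<..}"
    and "integral {0<..} f = (\<integral>u. of_real (exp u) * f (exp u) \<partial>lborel)"
    by (simp_all add: range_exp_real)
qed

section \<open>Euler's integral in the logarithmic variable, and Gaussian integrals\<close>

lemma Gamma_integral_exp:
  assumes "Re s > 0"
  shows "has_bochner_integral lborel (\<lambda>u. exp (s * of_real u) * of_real (exp (- exp u))) (Gamma s)"
proof -
  define f where "f = (\<lambda>t. of_real t powr (s - 1) / complex_of_real (exp t))"
  have "f absolutely_integrable_on (exp ` UNIV) \<and> integral (exp ` UNIV) f = Gamma s"
    using absolutely_integrable_Gamma_integral'[OF assms] Gamma_integral_complex'[OF assms]
    by (simp add: range_exp_real f_def integral_unique)
  then have *: "(\<lambda>u. \<bar>exp u\<bar> *\<^sub>R f (exp u)) absolutely_integrable_on UNIV \<and>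
      integral UNIV (\<lambda>u. \<bar>exp u\<bar> *\<^sub>R f (exp u)) = Gamma s"
    by (subst has_absolute_integral_change_of_variables_real)
       (auto intro!: derivative_eq_intros simp: inj_on_def)
  have eq: "\<bar>exp u\<bar> *\<^sub>R f (exp u) = exp (s * of_real u) * of_real (exp (- exp u))" for u :: real
  proof -
    have "of_real (exp u) powr (s - 1) = exp ((s - 1) * of_real u)"
      by (simp add: powr_def Ln_of_real)
    then show ?thesis
      by (simp add: f_def scaleR_conv_of_real exp_of_real[symmetric] exp_minus field_simps exp_diff exp_add
        ring_distribs)
  qed
  have int: "integrable lborel (\<lambda>u. exp (s * of_real u) * of_real (exp (- exp u)))"
    using * unfolding eq by (subst integrable_completion[symmetric]) (auto simp: set_integrable_def)
  moreover have "integral\<^sup>L lborel (\<lambda>u. exp (s * of_real u) * of_real (exp (- exp u))) = Gamma s"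
    using * integral_lborel[OF int] unfolding eq by simp
  ultimately show ?thesis by (simp add: has_bochner_integral_iff)
qed

lemma integral_std_normal_exp:
  "has_bochner_integral lborel
     (\<lambda>x. exp (\<i> * of_real (t * x)) * of_real (exp (- (x^2) / 2))) (of_real (sqrt (2 * pi) * exp (- (t^2) / 2)))"
proof -
  have int: "integrable lborel (\<lambda>x. exp (\<i> * of_real (t * x)) * of_real (exp (- (x^2) / 2)))"
  proof (rule Bochner_Integration.integrable_bound)
    show "integrable lborel (\<lambda>x. sqrt (2 * pi) * std_normal_density x)"
      by (intro integrable_mult_right) (simp add: integrable_normal_density)
  qed (auto simp: norm_mult std_normal_density_def simp flip: exp_of_real)
  have "char std_normal_distribution t =
      (\<integral>x. std_normal_density x *\<^sub>R exp (\<i> * of_real (t * x)) \<partial>lborel)"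
    unfolding char_def by (subst integral_density) (auto simp: mult_ac)
  also have "\<dots> = (\<integral>x. of_real (1 / sqrt (2 * pi)) * (exp (\<i> * of_real (t * x)) * of_real (exp (- (x^2) / 2))) \<partial>lborel)"
    by (intro Bochner_Integration.integral_cong) (auto simp: std_normal_density_def scaleR_conv_of_real)
  also have "\<dots> = of_real (1 / sqrt (2 * pi)) * (\<integral>x. exp (\<i> * of_real (t * x)) * of_real (exp (- (x^2) / 2)) \<partial>lborel)"
    by simp
  finally have "(\<integral>x. exp (\<i> * of_real (t * x)) * of_real (exp (- (x^2) / 2)) \<partial>lborel)
     = of_real (sqrt (2 * pi)) * char std_normal_distribution t"
    by simp
  then show ?thesis using int by (simp add: has_bochner_integral_iff char_std_normal_distribution)
qed

lemma integral_gaussian_exp: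
  fixes n :: real
  assumes "n > 0"
  shows "has_bochner_integral lborel
     (\<lambda>t. exp (\<i> * of_real (t * x)) * of_real (exp (- ((t / n)^2) / 2)))
     (of_real (n * sqrt (2 * pi) * exp (- ((n * x)^2) / 2)))"
proof -
  have "has_bochner_integral lborel (\<lambda>t. exp (\<i> * of_real ((n * x) * (0 + (1 / n) * t))) * of_real (exp (- ((0 + (1 / n) * t)^2) / 2)))
     (of_real (sqrt (2 * pi) * exp (- ((n * x)^2) / 2)) /\<^sub>R \<bar>1 / n\<bar>)"
    using integral_std_normal_exp[of "n * x"] assms
    by (subst (asm) lborel_has_bochner_integral_real_affine_iff[where c = "1 / n" and t = 0]) auto
  then show ?thesis
    using assms by (simp add: scaleR_conv_of_real field_simps)
qed

text \<open>Gaussian summation: insert \<open>exp (- (t / n)\<^sup>2 / 2)\<close>, use Fubini, and let \<open>n\<close> tend to infinity.\<close>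

theorem fourier_inversion:
  fixes f :: "real \<Rightarrow> complex"
  assumes cont: "continuous_on UNIV f" and int: "integrable lborel f"
    and bdd: "\<And>x. norm (f x) \<le> B"
  defines "F \<equiv> (\<lambda>t. \<integral>u. f u * exp (\<i> * of_real (t * u)) \<partial>lborel)"
  assumes intF: "integrable lborel F"
  shows "f v = 1 / (2 * of_real pi) * (\<integral>t. F t * exp (- \<i> * of_real (t * v)) \<partial>lborel)"
proof -
  have [measurable]: "f \<in> borel_measurable borel"
    using cont by (rule borel_measurable_continuous_onI)
  have [measurable]: "F \<in> borel_measurable borel"
    using intF by simp
  define L where "L = (\<lambda>n. \<integral>t. F t * exp (- \<i> * of_real (t * v)) * of_real (exp (- ((t / real (Suc n))^2) / 2)) \<partial>lborel)"
  \<comment> \<open>The transform of the damping Gaussian is a Gaussian of width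
    \<open>1 / Suc n\<close> around \<open>v\<close>; the substitution
    \<open>w = Suc n * (u - v)\<close> fixes the weight and lets \<open>f\<close> be sampled ever
    closer to \<open>v\<close>.\<close>
  have L_eq: "L n = of_real (sqrt (2 * pi)) * (\<integral>w. f (v + w / real (Suc n)) * of_real (exp (- (w^2) / 2)) \<partial>lborel)" for n
  proof -
    define m where "m = real (Suc n)"
    have m: "m > 0" by (simp add: m_def)
    let ?g = "\<lambda>t. exp (- ((t / m)^2) / 2)"
    have intg: "integrable lborel ?g"
    proof -
      have "integrable lborel (\<lambda>t. exp (\<i> * of_real (t * 0)) * complex_of_real (?g t))"
        using integral_gaussian_exp[OF m, of 0] by (simp add: has_bochner_integral_iff)
      then have "integrable lborel (\<lambda>t. complex_of_real (?g t))" by simp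
      then show ?thesis by (simp only: complex_of_real_integrable_eq)
    qed
    have "L n = (\<integral>t. (\<integral>u. f u * exp (\<i> * of_real (t * (u - v))) * of_real (?g t) \<partial>lborel) \<partial>lborel)"
      unfolding L_def m_def[symmetric]
    proof (intro Bochner_Integration.integral_cong refl)
      fix t
      have "F t * exp (- \<i> * of_real (t * v)) * of_real (?g t)
         = (\<integral>u. f u * exp (\<i> * of_real (t * u)) * (exp (- \<i> * of_real (t * v)) * of_real (?g t)) \<partial>lborel)"
        unfolding F_def by simp
      also have "\<dots> = (\<integral>u. f u * exp (\<i> * of_real (t * (u - v))) * of_real (?g t) \<partial>lborel)"
        by (intro Bochner_Integration.integral_cong)
           (auto simp: exp_diff exp_minus field_simps ring_distribs)
      finally show "F t * exp (- \<i> * of_real (t * v)) * of_real (?g t) = \<dots>" .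
    qed
    also have "\<dots> = (\<integral>u. (\<integral>t. f u * exp (\<i> * of_real (t * (u - v))) * of_real (?g t) \<partial>lborel) \<partial>lborel)"
    proof (rule lborel_pair.Fubini_integral)
      show "integrable (lborel \<Otimes>\<^sub>M lborel) (\<lambda>(u, t). f u * exp (\<i> * of_real (t * (u - v))) * of_real (?g t))"
      proof (rule lborel_pair.Fubini_integrable)
        have "(\<lambda>x. \<integral>y. norm (case (x, y) of (u, t) \<Rightarrow> f u * exp (\<i> * of_real (t * (u - v))) * of_real (?g t)) \<partial>lborel)
          = (\<lambda>u. norm (f u) * (\<integral>t. ?g t \<partial>lborel))"
          by (simp add: norm_mult)
        then show "integrable lborel (\<lambda>x. \<integral>y. norm (case (x, y) of (u, t) \<Rightarrow> f u * exp (\<i> * of_real (t * (u - v))) * of_real (?g t)) \<partial>lborel)"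
          using int by simp
        show "AE x in lborel. integrable lborel (\<lambda>y. case (x, y) of (u, t) \<Rightarrow> f u * exp (\<i> * of_real (t * (u - v))) * of_real (?g t))"
        proof (rule AE_I2)
          fix u
          show "integrable lborel (\<lambda>y. case (u, y) of (u, t) \<Rightarrow> f u * exp (\<i> * of_real (t * (u - v))) * of_real (?g t))"
            by (rule Bochner_Integration.integrable_bound[where f = "\<lambda>t. norm (f u) * ?g t"])
               (use intg in \<open>auto simp: norm_mult\<close>)
        qed
      qed measurable
    qed
    also have "\<dots> = (\<integral>u. f u * of_real (m * sqrt (2 * pi) * exp (- ((m * (u - v))^2) / 2)) \<partial>lborel)"
      by (simp only: mult.assoc integral_mult_right_zero has_bochner_integral_integral_eq[OF integral_gaussian_exp[OF m]])
    also have "\<dots> = (\<integral>w. f (v + w / m) * of_real (sqrt (2 * pi) * exp (- (w^2) / 2)) \<partial>lborel)"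
    proof -
      let ?h = "\<lambda>u. f u * of_real (m * sqrt (2 * pi) * exp (- ((m * (u - v))^2) / 2))"
      have "integral\<^sup>L lborel ?h = (\<integral>w. \<bar>1 / m\<bar> *\<^sub>R ?h (v + 1 / m * w) \<partial>lborel)"
        using m lborel_integral_real_affine[of "1 / m" ?h v] by (simp only: integral_scaleR_right) simp
      also have "\<dots> = (\<integral>w. f (v + w / m) * of_real (sqrt (2 * pi) * exp (- (w^2) / 2)) \<partial>lborel)"
        using m by (intro Bochner_Integration.integral_cong) (simp_all add: scaleR_conv_of_real)
      finally show ?thesis .
    qed
    also have "\<dots> = of_real (sqrt (2 * pi)) * (\<integral>w. f (v + w / m) * of_real (exp (- (w^2) / 2)) \<partial>lborel)"
      by (simp only: of_real_mult mult.left_commute[of "f _"] integral_mult_right_zero)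
    finally show ?thesis by (simp add: m_def)
  qed
  have "L \<longlonglongrightarrow> (\<integral>t. F t * exp (- \<i> * of_real (t * v)) \<partial>lborel)"
    unfolding L_def
  proof (rule integral_dominated_convergence[where w = "\<lambda>t. norm (F t)"])
    show "AE t in lborel. (\<lambda>n. F t * exp (- \<i> * of_real (t * v)) * of_real (exp (- ((t / real (Suc n))^2) / 2)))
       \<longlonglongrightarrow> F t * exp (- \<i> * of_real (t * v))"
    proof (rule AE_I2)
      fix t
      have "(\<lambda>n. F t * exp (- \<i> * of_real (t * v)) * of_real (exp (- ((t / real (Suc n))^2) / 2)))
        \<longlonglongrightarrow> F t * exp (- \<i> * of_real (t * v)) * of_real (exp (- (0^2) / 2))"
        by (intro tendsto_intros LIMSEQ_Suc[OF lim_const_over_n]) auto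
      then show "(\<lambda>n. F t * exp (- \<i> * of_real (t * v)) * of_real (exp (- ((t / real (Suc n))^2) / 2)))
       \<longlonglongrightarrow> F t * exp (- \<i> * of_real (t * v))" by (simp del: of_nat_Suc)
    qed
    show "AE t in lborel. norm (F t * exp (- \<i> * of_real (t * v)) * of_real (exp (- ((t / real (Suc n))^2) / 2))) \<le> norm (F t)" for n
      by (intro AE_I2) (simp add: norm_mult mult_left_le)
  qed (use intF in auto)
  \<comment> \<open>Here boundedness of \<open>f\<close> gives the majorant and continuity at
    \<open>v\<close> the pointwise limit. The mass of the Gaussian is a second
    \<open>sqrt (2 * pi)\<close>, whence the constant \<open>2 * pi\<close>.\<close>
  moreover have "L \<longlonglongrightarrow> of_real (sqrt (2 * pi)) * (\<integral>w. f v * of_real (exp (- (w^2) / 2)) \<partial>lborel)"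
    unfolding L_eq
  proof (intro tendsto_mult tendsto_const integral_dominated_convergence[where w = "\<lambda>w. B * exp (- (w^2) / 2)"])
    have gauss: "integrable lborel (\<lambda>w::real. exp (- (w^2) / 2))"
    proof -
      have "integrable lborel (\<lambda>w. complex_of_real (exp (- (w^2) / 2)))"
        using integral_std_normal_exp[of 0] by (simp add: has_bochner_integral_iff)
      then show ?thesis by (simp only: complex_of_real_integrable_eq)
    qed
    then show "integrable lborel (\<lambda>w. B * exp (- (w^2) / 2))" by simp
    show "AE w in lborel. (\<lambda>n. f (v + w / real (Suc n)) * of_real (exp (- (w^2) / 2))) \<longlonglongrightarrow> f v * of_real (exp (- (w^2) / 2))"
    proof (intro AE_I2 tendsto_mult tendsto_const)
      fix w
      have "(\<lambda>n. v + w / real (Suc n)) \<longlonglongrightarrow> v + 0"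
        by (intro tendsto_intros LIMSEQ_Suc[OF lim_const_over_n])
      then have "(\<lambda>n. v + w / real (Suc n)) \<longlonglongrightarrow> v" by (simp del: of_nat_Suc)
      moreover have "isCont f v" using cont continuous_on_eq_continuous_at[of UNIV f] by auto
      ultimately show "(\<lambda>n. f (v + w / real (Suc n))) \<longlonglongrightarrow> f v"
        by (rule isCont_tendsto_compose[rotated])
    qed
    show "AE w in lborel. norm (f (v + w / real (Suc n)) * of_real (exp (- (w^2) / 2))) \<le> B * exp (- (w^2) / 2)" for n
      using bdd by (intro AE_I2) (simp add: norm_mult)
  qed auto
  ultimately have "(\<integral>t. F t * exp (- \<i> * of_real (t * v)) \<partial>lborel)
      = of_real (sqrt (2 * pi)) * (\<integral>w. f v * of_real (exp (- (w^2) / 2)) \<partial>lborel)"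
    by (rule LIMSEQ_unique)
  also have "(\<integral>w. f v * of_real (exp (- (w^2) / 2)) \<partial>lborel) = f v * of_real (sqrt (2 * pi))"
    using integral_std_normal_exp[of 0] by (simp add: has_bochner_integral_iff)
  also have "of_real (sqrt (2 * pi)) * (f v * of_real (sqrt (2 * pi))) = f v * of_real (sqrt (2 * pi) * sqrt (2 * pi))"
    by (simp only: of_real_mult mult_ac)
  also have "sqrt (2 * pi) * sqrt (2 * pi) = 2 * pi" by simp
  finally show ?thesis by simp
qed

section \<open>The zeta function on the right half-plane\<close>

text \<open>
  These terms sum to \<open>(s - 1) \<zeta>(s)\<close> for \<open>Re s > 0\<close>: the differences telescope to
  \<open>N powr (1 - s)\<close>, which removes the divergence of \<open>\<Sum> n powr (- s)\<close> to the left of \<open>Re s = 1\<close>.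
\<close>

definition zeta_term :: "nat \<Rightarrow> complex \<Rightarrow> complex" where
  "zeta_term n s = (s - 1) * of_nat (Suc n) powr (- s) + of_nat (Suc n) powr (1 - s) - of_nat n powr (1 - s)"

lemma zeta_term_sum:
  assumes "s \<noteq> 1"
  shows "(\<Sum>n<N. zeta_term n s) = (s - 1) * (\<Sum>n<N. of_nat (Suc n) powr (- s)) + of_nat N powr (1 - s)"
  using assms by (induction N) (simp_all add: zeta_term_def algebra_simps)

lemma vector_differentiable_bound:
  fixes f :: "real \<Rightarrow> 'a::real_normed_vector"
  assumes "convex S" "\<And>u. u \<in> S \<Longrightarrow> (f has_vector_derivative f' u) (at u within S)"
    and "\<And>u. u \<in> S \<Longrightarrow> norm (f' u) \<le> B" "x \<in> S" "y \<in> S"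
  shows "norm (f x - f y) \<le> B * norm (x - y)"
proof (rule differentiable_bound[where f' = "\<lambda>u h. h *\<^sub>R f' u"])
  show "onorm (\<lambda>h. h *\<^sub>R f' u) \<le> B" if "u \<in> S" for u
    using assms(3)[OF that] by (intro onorm_le) (simp add: mult.commute[of B] mult_left_mono)
qed (use assms in \<open>auto simp: has_vector_derivative_def\<close>)

lemma powr_minus_diff_bound:
  fixes s :: complex and x y :: real
  assumes "0 < x" "x \<le> y" "Re s > 0"
  shows "norm (of_real x powr (- s) - of_real y powr (- s)) \<le> norm s * x powr (- Re s - 1) * (y - x)"
proof -
  have "norm (of_real x powr (- s) - of_real y powr (- s)) \<le> norm s * x powr (- Re s - 1) * norm (x - y)"
  proof (rule vector_differentiable_bound[where S = "{x..y}" and f' = "\<lambda>u. - s * of_real u powr (- s - 1)"])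
    fix u assume u: "u \<in> {x..y}"
    then have "u > 0" using assms by auto
    have "((\<lambda>w. w powr (- s)) has_field_derivative - s * of_real u powr (- s - 1)) (at (of_real u))"
      using \<open>u > 0\<close> by (intro has_field_derivative_powr) auto
    then show "((\<lambda>u. of_real u powr (- s)) has_vector_derivative - s * of_real u powr (- s - 1)) (at u within {x..y})"
      by (rule has_vector_derivative_real_field)
    have "u powr (- Re s - 1) \<le> x powr (- Re s - 1)"
      using u assms by (intro powr_mono2') auto
    then show "norm (- s * of_real u powr (- s - 1)) \<le> norm s * x powr (- Re s - 1)"
      using \<open>u > 0\<close> by (simp add: norm_mult norm_powr_real_powr mult_left_mono)
  qed (use assms in auto)
  then show ?thesis using assms by simp
qed

text \<open>The term is the increment over \<open>[n, n + 1]\<close> of the auxiliary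
  \<open>h\<close>, whose derivative is \<open>1 - s\<close> times a difference of two values of
  \<open>u powr (- s)\<close>. Using the mean value inequality twice lowers the exponent to
  \<open>- Re s - 1\<close>, which is summable for every \<open>Re s > 0\<close>.\<close>

lemma zeta_term_bound:
  assumes "Re s > 0" "n > 0"
  shows "norm (zeta_term n s) \<le> norm (1 - s) * norm s * real n powr (- Re s - 1)"
proof -
  define h where "h = (\<lambda>u::real. of_real u powr (1 - s) + (s - 1) * of_nat (Suc n) powr (- s) * of_real u)"
  have "norm (h (real (Suc n)) - h (real n)) \<le> norm (1 - s) * norm s * real n powr (- Re s - 1) * norm (real (Suc n) - real n)"
  proof (rule vector_differentiable_bound[where S = "{real n..real (Suc n)}" and
        f' = "\<lambda>u. (1 - s) * (of_real u powr (- s) - of_nat (Suc n) powr (- s))"])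
    fix u assume u: "u \<in> {real n..real (Suc n)}"
    then have "u > 0" using assms by auto
    have "((\<lambda>w. w powr (1 - s) + (s - 1) * c * w) has_field_derivative
        (1 - s) * of_real u powr (1 - s - 1) + (s - 1) * c) (at (of_real u))" for c
      using \<open>u > 0\<close> by (intro derivative_intros DERIV_cmult_Id has_field_derivative_powr) auto
    from has_vector_derivative_real_field[OF this[of "of_nat (Suc n) powr (- s)"]]
    show "(h has_vector_derivative (1 - s) * (of_real u powr (- s) - of_nat (Suc n) powr (- s))) (at u within {real n..real (Suc n)})"
      unfolding h_def by (simp add: algebra_simps)
    have "norm (of_real u powr (- s) - of_real (real (Suc n)) powr (- s))
        \<le> norm s * u powr (- Re s - 1) * (real (Suc n) - u)"
      using u \<open>u > 0\<close> assms by (intro powr_minus_diff_bound) auto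
    also have "\<dots> \<le> norm s * real n powr (- Re s - 1) * 1"
      using u assms by (intro mult_mono mult_left_mono powr_mono2') auto
    finally show "norm ((1 - s) * (of_real u powr (- s) - of_nat (Suc n) powr (- s)))
        \<le> norm (1 - s) * norm s * real n powr (- Re s - 1)"
      by (simp add: norm_mult mult_left_mono mult.assoc)
  qed (use assms in auto)
  also have "h (real (Suc n)) - h (real n) = zeta_term n s"
    by (simp add: h_def zeta_term_def algebra_simps)
  finally show ?thesis by simp
qed

lemma zeta_term_holomorphic: "zeta_term n holomorphic_on {s. Re s > 0}"
proof (cases "n = 0")
  case True
  \<comment> \<open>By the convention \<open>0 powr w = 0\<close>, the term for \<open>n = 0\<close>
    is \<open>(s - 1) + 1\<close>.\<close>
  then have "zeta_term n = (\<lambda>s. s)" by (auto simp: zeta_term_def fun_eq_iff)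
  then show ?thesis by simp
next
  case False
  then show ?thesis unfolding zeta_term_def by (intro holomorphic_intros) auto
qed

definition zeta_reg :: "complex \<Rightarrow> complex" where
  "zeta_reg s = (\<Sum>n. zeta_term n s)"

lemma zeta_reg_sums_holomorphic:
  shows zeta_reg_sums: "Re s > 0 \<Longrightarrow> (\<lambda>n. zeta_term n s) sums zeta_reg s"
    and zeta_reg_holomorphic: "zeta_reg holomorphic_on {s. Re s > 0}"
proof -
  have open_S: "open {s. Re s > 0}" by (rule open_halfspace_Re_gt)
  have "\<exists>g g'. \<forall>x \<in> {s. Re s > 0}. ((\<lambda>n. zeta_term n x) sums g x) \<and> ((\<lambda>n. deriv (zeta_term n) x) sums g' x)
     \<and> (g has_field_derivative g' x) (at x)"
  proof (rule series_and_derivative_comparison_local[OF open_S])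
    fix n x assume "x \<in> {s. Re s > 0}"
    then show "(zeta_term n has_field_derivative deriv (zeta_term n) x) (at x)"
      using zeta_term_holomorphic open_S holomorphic_derivI by blast
  next
    fix x assume "x \<in> {s. Re s > 0}"
    then have x: "Re x > 0" by simp
    \<comment> \<open>On the ball of this radius the real part stays at least \<open>d\<close>, so
      one exponent \<open>- d - 1\<close> serves all its points.\<close>
    define d where "d = Re x / 2"
    have "d > 0" using x by (simp add: d_def)
    define h where "h = (\<lambda>n. (norm x + d + 1) * (norm x + d) * real n powr (- d - 1))"
    have "summable h" unfolding h_def using \<open>d > 0\<close>
      by (intro summable_mult) (simp add: summable_real_powr_iff)
    moreover have "\<forall>\<^sub>F n in sequentially. \<forall>y\<in>ball x d \<inter> {s. Re s > 0}. norm (zeta_term n y) \<le> h n"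
      using eventually_gt_at_top[of 0]
    proof eventually_elim
      case (elim n)
      show ?case
      proof
        fix y assume y: "y \<in> ball x d \<inter> {s. Re s > 0}"
        have "norm y - norm x \<le> d" using y norm_triangle_ineq2[of y x] by (auto simp: dist_norm norm_minus_commute)
        then have ny: "norm y \<le> norm x + d" by simp
        have "norm (1 - y) \<le> norm x + d + 1" using norm_triangle_ineq4[of 1 y] ny by simp
        moreover have "Re x - Re y \<le> d" using y complex_Re_le_cmod[of "x - y"] by (auto simp: dist_norm)
        then have "d \<le> Re y" by (simp add: d_def)
        then have "real n powr (- Re y - 1) \<le> real n powr (- d - 1)"
          using elim by (intro powr_mono) auto
        ultimately have "norm (1 - y) * norm y * real n powr (- Re y - 1) \<le> h n"
          unfolding h_def using ny \<open>d > 0\<close> by (intro mult_mono) auto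
        then show "norm (zeta_term n y) \<le> h n"
          using zeta_term_bound[of y n] y elim by auto
      qed
    qed
    ultimately show "\<exists>d h. 0 < d \<and> summable h \<and>
        (\<forall>\<^sub>F n in sequentially. \<forall>y\<in>ball x d \<inter> {s. Re s > 0}. norm (zeta_term n y) \<le> h n)"
      using \<open>d > 0\<close> by blast
  qed
  then obtain g g' where g: "\<And>x. Re x > 0 \<Longrightarrow> (\<lambda>n. zeta_term n x) sums g x"
    "\<And>x. Re x > 0 \<Longrightarrow> (g has_field_derivative g' x) (at x)" by auto
  have eq: "zeta_reg x = g x" if "Re x > 0" for x
    using g(1)[OF that] by (simp add: zeta_reg_def sums_iff)
  show "(\<lambda>n. zeta_term n s) sums zeta_reg s" if "Re s > 0"
    using g(1)[OF that] eq[OF that] by simp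
  have "g holomorphic_on {s. Re s > 0}"
    using g(2) open_S by (subst holomorphic_on_open) auto
  then show "zeta_reg holomorphic_on {s. Re s > 0}"
    by (rule holomorphic_transform) (use eq in auto)
qed

lemma zeta_reg_dirichlet:
  assumes "Re s > 1"
  shows "(\<lambda>n. 1 / of_nat (Suc n) powr s) sums (zeta_reg s / (s - 1))"
proof -
  have s: "s \<noteq> 1" using assms by auto
  have "(\<lambda>N. of_nat N powr (1 - s) :: complex) \<longlonglongrightarrow> 0"
  proof (rule tendsto_norm_zero_cancel)
    have "(\<lambda>N. real N powr (1 - Re s)) \<longlonglongrightarrow> 0"
      using assms by (intro tendsto_neg_powr filterlim_real_sequentially) auto
    moreover have "norm (of_nat N powr (1 - s) :: complex) = real N powr (1 - Re s)" for N
      using norm_powr_real_powr[of "of_nat N" "1 - s"] by (cases "N = 0") auto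
    ultimately show "(\<lambda>N. norm (of_nat N powr (1 - s) :: complex)) \<longlonglongrightarrow> 0" by simp
  qed
  moreover have "(\<lambda>N. \<Sum>n<N. zeta_term n s) \<longlonglongrightarrow> zeta_reg s"
    using zeta_reg_sums[of s] assms by (simp add: sums_def)
  ultimately have "(\<lambda>N. ((\<Sum>n<N. zeta_term n s) - of_nat N powr (1 - s)) / (s - 1)) \<longlonglongrightarrow> (zeta_reg s - 0) / (s - 1)"
    using s by (intro tendsto_intros) auto
  moreover have "((\<Sum>n<N. zeta_term n s) - of_nat N powr (1 - s)) / (s - 1) = (\<Sum>n<N. 1 / of_nat (Suc n) powr s)" for N
    using s by (simp add: zeta_term_sum powr_minus field_simps del: of_nat_Suc)
  ultimately show ?thesis by (simp add: sums_def del: of_nat_Suc)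
qed

text \<open>The form in which zeta enters Muentz' formula: the subtracted power is the Mellin factor
  contributed by the truncated integral \<open>A (real N * x) / x\<close>.\<close>

lemma zeta_reg_strip_limit:
  assumes "0 < Re s" "Re s < 1"
  shows "(\<lambda>N. (\<Sum>n<N. of_nat (Suc n) powr (- s)) - of_nat N powr (1 - s) / (1 - s)) \<longlonglongrightarrow> zeta_reg s / (s - 1)"
proof -
  have s: "s \<noteq> 1" using assms by auto
  have "(\<lambda>N. (\<Sum>n<N. zeta_term n s) / (s - 1)) \<longlonglongrightarrow> zeta_reg s / (s - 1)"
    using zeta_reg_sums[of s] assms s by (intro tendsto_intros) (auto simp: sums_def)
  moreover have "(\<Sum>n<N. zeta_term n s) / (s - 1)
      = (\<Sum>n<N. of_nat (Suc n) powr (- s)) - of_nat N powr (1 - s) / (1 - s)" for N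
    using s by (simp add: zeta_term_sum field_simps del: of_nat_Suc)
  ultimately show ?thesis by simp
qed

section \<open>Muentz' formula\<close>

lemma integrable_exp_minus_abs:
  fixes \<delta> :: real
  assumes "\<delta> > 0"
  shows "integrable lborel (\<lambda>u. exp (- \<delta> * \<bar>u\<bar>))"
proof -
  have "(\<lambda>x. exp (- \<delta> * x)) absolutely_integrable_on {0..}"
    using integrable_on_exp_minus_to_infinity[OF assms, of 0]
    by (intro nonnegative_absolutely_integrable_1) auto
  then have "integrable lborel (\<lambda>x. indicator {0..} x *\<^sub>R exp (- \<delta> * x))"
    unfolding set_integrable_def by (subst (asm) integrable_completion) auto
  then have *: "integrable lborel (\<lambda>x. indicator {0..} x *\<^sub>R exp (- \<delta> * \<bar>x\<bar>))"
    by (rule Bochner_Integration.integrable_cong[THEN iffD1, rotated 2]) (auto simp: indicator_def)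
  have "has_bochner_integral lborel (\<lambda>u. exp (- \<delta> * \<bar>u\<bar>)) (2 * (\<integral>x. indicator {0..} x *\<^sub>R exp (- \<delta> * \<bar>x\<bar>) \<partial>lborel))"
    using has_bochner_integral_even_function[OF has_bochner_integral_integrable[OF *]] by simp
  then show ?thesis by (simp add: has_bochner_integral_iff)
qed

text \<open>Scaling by \<open>c\<close> is translation of \<open>u\<close> by
  \<open>ln c\<close>.\<close>

lemma mellin_scale:
  fixes f :: "real \<Rightarrow> complex"
  assumes "has_bochner_integral lborel (\<lambda>u. f (exp u) * exp (s * of_real u)) I" and "c > 0"
  shows "has_bochner_integral lborel (\<lambda>u. f (c * exp u) * exp (s * of_real u)) (of_real c powr (- s) * I)"
proof -
  have "has_bochner_integral lborel (\<lambda>u. f (exp (ln c + 1 * u)) * exp (s * of_real (ln c + 1 * u))) (I /\<^sub>R \<bar>1\<bar>)"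
    using assms(1) by (subst (asm) lborel_has_bochner_integral_real_affine_iff[where c = 1 and t = "ln c"]) auto
  then have "has_bochner_integral lborel (\<lambda>u. of_real c powr (- s) * (f (exp (ln c + 1 * u)) * exp (s * of_real (ln c + 1 * u))))
      (of_real c powr (- s) * (I /\<^sub>R \<bar>1\<bar>))"
    by (rule has_bochner_integral_mult_right)
  moreover have "of_real c powr (- s) * (f (exp (ln c + 1 * u)) * exp (s * of_real (ln c + 1 * u)))
      = f (c * exp u) * exp (s * of_real u)" for u
    using assms(2) by (simp add: powr_def Ln_of_real exp_add exp_minus field_simps ring_distribs)
  ultimately show ?thesis by simp
qed

text \<open>\<open>A\<close> is the antiderivative of the kernel \<open>k\<close> that vanishes at
  0, and \<open>C\<close> bounds it, so the integral of \<open>k\<close> over the half-line is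
  finite. \<open>H\<close> is the sum of \<open>k (n * x)\<close> minus \<open>1 / x\<close> times
  that integral, presented as a limit in which sum and integral are truncated at the same point;
  this keeps each approximant Mellin transformable.\<close>

locale muentz =
  fixes k A H :: "real \<Rightarrow> real" and C :: real
  assumes k_nonneg: "x \<ge> 0 \<Longrightarrow> k x \<ge> 0"
    and k_antimono: "0 \<le> x \<Longrightarrow> x \<le> y \<Longrightarrow> k y \<le> k x"
    and k_cont: "continuous_on UNIV k"
    and A_0: "A 0 = 0"
    and A_deriv: "(A has_real_derivative k x) (at x)"
    and A_le: "A x \<le> C"
    and H_lim: "x > 0 \<Longrightarrow> (\<lambda>N. (\<Sum>n<N. k (real (Suc n) * x)) - A (real N * x) / x) \<longlonglongrightarrow> H x"
begin

lemma A_diff: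
  assumes "0 \<le> x" "x \<le> y"
  shows "k y * (y - x) \<le> A y - A x" "A y - A x \<le> k x * (y - x)"
proof -
  have "\<exists>z. x \<le> z \<and> z \<le> y \<and> A y - A x = (y - x) * k z"
  proof (cases "x = y")
    case False
    then have "x < y" using assms by simp
    from MVT2[OF this A_deriv] obtain z where "x < z" "z < y" "A y - A x = (y - x) * k z" by blast
    then show ?thesis by (intro exI[of _ z]) simp
  qed auto
  then obtain z where z: "x \<le> z" "z \<le> y" "A y - A x = (y - x) * k z" by blast
  then have "k y \<le> k z" "k z \<le> k x" using assms k_antimono by auto
  then show "k y * (y - x) \<le> A y - A x" "A y - A x \<le> k x * (y - x)"
    using assms z by (auto simp: mult.commute[of "y - x"] intro!: mult_right_mono)
qed

lemma A_cont: "continuous_on UNIV A"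
  using A_deriv DERIV_isCont by (auto simp: continuous_on_eq_continuous_at)

lemma A_nonneg: "x \<ge> 0 \<Longrightarrow> A x \<ge> 0"
  using A_diff(1)[of 0 x] k_nonneg[of x] by (simp add: A_0) (meson mult_nonneg_nonneg order_trans)

lemma C_nonneg: "C \<ge> 0"
  using A_le[of 0] by (simp add: A_0)

lemma measurable_kA [measurable]: "k \<in> borel_measurable borel" "A \<in> borel_measurable borel"
  using k_cont A_cont by (auto intro: borel_measurable_continuous_onI)

text \<open>For \<open>u < 0\<close> the estimate \<open>A x \<le> k 0 * x\<close> gives decay at
  rate \<open>\<sigma>\<close>, for \<open>u \<ge> 0\<close> the bound \<open>C\<close> gives decay
  at rate \<open>1 - \<sigma>\<close>. Since \<open>k\<close> decreases,
  \<open>x * k x \<le> A x\<close>, so the same majorant serves \<open>k\<close>.\<close>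

lemma dominated:
  assumes "0 < \<sigma>" "\<sigma> < 1"
  defines "D \<equiv> (\<lambda>u. max (k 0) C * exp (- min \<sigma> (1 - \<sigma>) * \<bar>u\<bar>))"
  shows "A (exp u) * exp ((\<sigma> - 1) * u) \<le> D u"
    and "k (exp u) * exp (\<sigma> * u) \<le> D u"
    and "integrable lborel D"
proof -
  have M: "0 \<le> max (k 0) C" using C_nonneg by auto
  show *: "A (exp u) * exp ((\<sigma> - 1) * u) \<le> D u"
  proof (cases "u \<ge> 0")
    case True
    have "A (exp u) * exp ((\<sigma> - 1) * u) \<le> max (k 0) C * exp ((\<sigma> - 1) * u)"
      using A_le[of "exp u"] by (intro mult_right_mono) auto
    also have "(\<sigma> - 1) * u \<le> - min \<sigma> (1 - \<sigma>) * \<bar>u\<bar>"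
      using True mult_right_mono[of "min \<sigma> (1 - \<sigma>)" "1 - \<sigma>" u] by (simp add: algebra_simps)
    finally show ?thesis using M by (simp add: D_def mult_left_mono)
  next
    case False
    have "A (exp u) * exp ((\<sigma> - 1) * u) \<le> (k 0 * exp u) * exp ((\<sigma> - 1) * u)"
      using A_diff(2)[of 0 "exp u"] by (intro mult_right_mono) (auto simp: A_0)
    also have "\<dots> = k 0 * exp (\<sigma> * u)" by (simp add: algebra_simps flip: exp_add)
    also have "\<dots> \<le> max (k 0) C * exp (\<sigma> * u)" by (intro mult_right_mono) auto
    also have "\<sigma> * u \<le> - min \<sigma> (1 - \<sigma>) * \<bar>u\<bar>"
      using False mult_right_mono_neg[of "min \<sigma> (1 - \<sigma>)" \<sigma> u] by (simp add: algebra_simps)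
    finally show ?thesis using M by (simp add: D_def mult_left_mono)
  qed
  have "k (exp u) * exp (\<sigma> * u) = (k (exp u) * exp u) * exp ((\<sigma> - 1) * u)"
    by (simp add: algebra_simps flip: exp_add)
  also have "\<dots> \<le> A (exp u) * exp ((\<sigma> - 1) * u)"
    using A_diff(1)[of 0 "exp u"] by (intro mult_right_mono) (auto simp: A_0)
  finally show "k (exp u) * exp (\<sigma> * u) \<le> D u" using * by simp
  show "integrable lborel D"
    unfolding D_def using assms by (intro integrable_mult_right integrable_exp_minus_abs) auto
qed

definition K :: "complex \<Rightarrow> complex" where
  "K s = (\<integral>u. of_real (k (exp u)) * exp (s * of_real u) \<partial>lborel)"

lemma integrable_k:
  assumes "0 < Re s" "Re s < 1"
  shows "has_bochner_integral lborel (\<lambda>u. of_real (k (exp u)) * exp (s * of_real u)) (K s)"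
proof -
  have "integrable lborel (\<lambda>u. of_real (k (exp u)) * exp (s * of_real u))"
    by (rule Bochner_Integration.integrable_bound[OF dominated(3)[OF assms]])
       (use dominated(2)[OF assms] k_nonneg in \<open>auto simp: norm_mult intro: order_trans[OF _ abs_ge_self]\<close>)
  then show ?thesis by (simp add: K_def has_bochner_integral_integrable)
qed

text \<open>Integration by parts without boundary terms: \<open>F\<close> tends to 0 at both ends,
  and its derivative \<open>F'\<close> is the integrand of \<open>K s\<close> plus
  \<open>(s - 1) * F\<close>.\<close>

lemma integral_A:
  assumes "0 < Re s" "Re s < 1"
  shows "has_bochner_integral lborel (\<lambda>u. of_real (A (exp u) / exp u) * exp (s * of_real u)) (K s / (1 - s))"
proof -
  have s: "s \<noteq> 1" using assms by auto
  define F where "F = (\<lambda>u. of_real (A (exp u)) * exp ((s - 1) * of_real u))"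
  have F_eq: "F u = of_real (A (exp u) / exp u) * exp (s * of_real u)" for u
    by (simp add: F_def exp_diff algebra_simps exp_of_real)
  let ?\<delta> = "min (Re s) (1 - Re s)"
  let ?D = "\<lambda>u. max (k 0) C * exp (- ?\<delta> * \<bar>u\<bar>)"
  have F_bound: "norm (F u) \<le> ?D u" for u
    using dominated(1)[OF assms, of u] A_nonneg[of "exp u"] by (simp add: F_def norm_mult)
  have [measurable]: "F \<in> borel_measurable borel" unfolding F_def by measurable
  have int_F: "integrable lborel F"
    by (rule Bochner_Integration.integrable_bound[OF dominated(3)[OF assms]])
       (use F_bound in \<open>auto intro: order_trans[OF _ abs_ge_self]\<close>)
  define F' where "F' = (\<lambda>u. of_real (k (exp u)) * exp (s * of_real u) + (s - 1) * F u)"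
  have int_F': "has_bochner_integral lborel F' (K s + (s - 1) * integral\<^sup>L lborel F)"
    unfolding F'_def using int_F
    by (intro has_bochner_integral_add integrable_k assms has_bochner_integral_mult_right has_bochner_integral_integrable)
  have "(LBINT u=-\<infinity>..\<infinity>. F' u) = 0 - 0"
  proof (rule interval_integral_FTC_integrable[where F = F])
    fix u
    have "((\<lambda>u. A (exp u)) has_real_derivative k (exp u) * exp u) (at u)"
      by (rule DERIV_chain2[OF A_deriv]) (auto intro!: derivative_eq_intros)
    then have 1: "((\<lambda>u. of_real (A (exp u)) :: complex) has_vector_derivative of_real (k (exp u) * exp u)) (at u)"
      by (rule has_vector_derivative_of_real)
    have "((\<lambda>w. exp ((s - 1) * w)) has_field_derivative (s - 1) * exp ((s - 1) * of_real u)) (at (of_real u))"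
      by (auto intro!: derivative_eq_intros)
    then have 2: "((\<lambda>u. exp ((s - 1) * of_real u)) has_vector_derivative (s - 1) * exp ((s - 1) * of_real u)) (at u)"
      by (rule has_vector_derivative_real_field)
    show "(F has_vector_derivative F' u) (at u)"
      unfolding F_def F'_def
      by (rule has_vector_derivative_eq_rhs[OF has_vector_derivative_mult[OF 1 2]])
         (simp add: algebra_simps exp_of_real[symmetric] flip: exp_add)
    have "continuous_on UNIV F'" unfolding F'_def F_def
      by (intro continuous_intros continuous_on_compose2[OF k_cont] continuous_on_compose2[OF A_cont]) auto
    then show "isCont F' u" by (simp add: continuous_on_eq_continuous_at)
  next
    show "set_integrable lborel (einterval (-\<infinity>) \<infinity>) F'"
      using int_F' by (simp add: set_integrable_def has_bochner_integral_iff)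
    have \<delta>: "?\<delta> > 0" using assms by auto
    have "((\<lambda>u. exp (?\<delta> * u)) \<longlongrightarrow> 0) at_bot"
      using \<delta> by (intro filterlim_compose[OF exp_at_bot] filterlim_tendsto_pos_mult_at_bot[OF tendsto_const _ filterlim_ident])
    then have "((\<lambda>u. max (k 0) C * exp (?\<delta> * u)) \<longlongrightarrow> 0) at_bot"
      by (rule tendsto_mult_right_zero)
    then have "(F \<longlongrightarrow> 0) at_bot"
    proof (rule Lim_null_comparison[rotated])
      show "\<forall>\<^sub>F u in at_bot. norm (F u) \<le> max (k 0) C * exp (?\<delta> * u)"
        using eventually_le_at_bot[of 0]
      proof eventually_elim
        case (elim u)
        then have "- ?\<delta> * \<bar>u\<bar> = ?\<delta> * u" by simp
        then show ?case using F_bound[of u] by metis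
      qed
    qed
    then show "((F \<circ> real_of_ereal) \<longlongrightarrow> 0) (at_right (-\<infinity>))"
      by (simp add: ereal_tendsto_simps1)
    have "((\<lambda>u. exp (- (?\<delta> * u))) \<longlongrightarrow> 0) at_top"
      using \<delta> by (intro filterlim_compose[OF exp_at_bot]
        filterlim_uminus_at_bot_at_top[THEN filterlim_compose] filterlim_tendsto_pos_mult_at_top[OF tendsto_const _ filterlim_ident])
    then have "((\<lambda>u. max (k 0) C * exp (- (?\<delta> * u))) \<longlongrightarrow> 0) at_top"
      by (rule tendsto_mult_right_zero)
    then have "(F \<longlongrightarrow> 0) at_top"
    proof (rule Lim_null_comparison[rotated])
      show "\<forall>\<^sub>F u in at_top. norm (F u) \<le> max (k 0) C * exp (- (?\<delta> * u))"
        using eventually_ge_at_top[of 0]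
      proof eventually_elim
        case (elim u)
        then have "- ?\<delta> * \<bar>u\<bar> = - (?\<delta> * u)" by simp
        then show ?case using F_bound[of u] by metis
      qed
    qed
    then show "((F \<circ> real_of_ereal) \<longlongrightarrow> 0) (at_left \<infinity>)"
      by (simp add: ereal_tendsto_simps1)
  qed auto
  then have "integral\<^sup>L lborel F' = 0"
    by (simp add: interval_lebesgue_integral_def set_lebesgue_integral_def)
  then have "K s + (s - 1) * integral\<^sup>L lborel F = 0"
    using has_bochner_integral_integral_eq[OF int_F'] by simp
  then have "integral\<^sup>L lborel F = K s / (1 - s)"
    using s by (simp add: field_simps add_eq_0_iff)
  then have "has_bochner_integral lborel F (K s / (1 - s))"
    using int_F by (simp add: has_bochner_integral_iff)
  then show ?thesis by (simp only: F_eq[abs_def])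
qed

definition S :: "nat \<Rightarrow> real \<Rightarrow> real" where
  "S N x = (\<Sum>n<N. k (real (Suc n) * x)) - A (real N * x) / x"

text \<open>As \<open>k\<close> decreases, the summand added with \<open>N + 1\<close> is at most
  the integral over the added interval, divided by \<open>x\<close>. The monotonicity supplies the
  majorant in \<open>mellin_H\<close>.\<close>

lemma S_antimono:
  assumes "x > 0"
  shows "antimono (\<lambda>N. S N x)"
proof (rule decseq_SucI)
  fix N
  have "k (real (Suc N) * x) * (real (Suc N) * x - real N * x) \<le> A (real (Suc N) * x) - A (real N * x)"
    using assms by (intro A_diff) (auto intro: mult_right_mono)
  then have "k (real (Suc N) * x) \<le> (A (real (Suc N) * x) - A (real N * x)) / x"
    using assms by (simp add: field_simps)
  then show "S (Suc N) x \<le> S N x"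
    by (simp add: S_def diff_divide_distrib)
qed

lemma mellin_S:
  assumes "0 < Re s" "Re s < 1"
  shows "has_bochner_integral lborel (\<lambda>u. of_real (S N (exp u)) * exp (s * of_real u))
     (K s * ((\<Sum>n<N. of_nat (Suc n) powr (- s)) - of_nat N powr (1 - s) / (1 - s)))"
proof -
  have 1: "has_bochner_integral lborel (\<lambda>u. of_real (k (real (Suc n) * exp u)) * exp (s * of_real u))
      (of_nat (Suc n) powr (- s) * K s)" for n
    using mellin_scale[where f = "\<lambda>x. of_real (k x)", OF integrable_k[OF assms], of "real (Suc n)"] by simp
  have 2: "has_bochner_integral lborel (\<lambda>u. of_real (A (real N * exp u) / exp u) * exp (s * of_real u))
      (of_nat N powr (1 - s) / (1 - s) * K s)"
  \<comment> \<open>At \<open>N = 0\<close> both sides vanish: \<open>A 0\<close> is 0, and so is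
    \<open>0 powr (1 - s)\<close> by convention.\<close>
  proof (cases "N = 0")
    case True
    then show ?thesis by (simp add: A_0 has_bochner_integral_zero)
  next
    case False
    have "has_bochner_integral lborel (\<lambda>u. of_nat N * (of_real (A (real N * exp u) / (real N * exp u)) * exp (s * of_real u)))
      (of_nat N * (of_real (real N) powr (- s) * (K s / (1 - s))))"
      by (intro has_bochner_integral_mult_right mellin_scale[where f = "\<lambda>x. of_real (A x / x)", OF integral_A[OF assms]])
         (use False in auto)
    also have "(of_nat N * (of_real (real N) powr (- s) * (K s / (1 - s)))) = of_nat N powr (1 - s) / (1 - s) * K s"
      using False by (simp add: powr_diff powr_minus field_simps)
    finally show ?thesis using False by (simp add: field_simps)
  qed
  have "has_bochner_integral lborel (\<lambda>u. (\<Sum>n<N. of_real (k (real (Suc n) * exp u)) * exp (s * of_real u)) -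
      of_real (A (real N * exp u) / exp u) * exp (s * of_real u))
     ((\<Sum>n<N. of_nat (Suc n) powr (- s) * K s) - of_nat N powr (1 - s) / (1 - s) * K s)"
    by (intro has_bochner_integral_diff has_bochner_integral_sum 1 2)
  also have "((\<Sum>n<N. of_nat (Suc n) powr (- s) * K s) - of_nat N powr (1 - s) / (1 - s) * K s)
     = K s * ((\<Sum>n<N. of_nat (Suc n) powr (- s)) - of_nat N powr (1 - s) / (1 - s))"
    by (simp add: right_diff_distrib sum_distrib_left mult.commute)
  also have "(\<lambda>u. (\<Sum>n<N. of_real (k (real (Suc n) * exp u)) * exp (s * of_real u)) -
      of_real (A (real N * exp u) / exp u) * exp (s * of_real u)) = (\<lambda>u. of_real (S N (exp u)) * exp (s * of_real u))"
    by (simp add: S_def left_diff_distrib sum_distrib_right fun_eq_iff del: of_nat_Suc)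
  finally show ?thesis .
qed

lemma measurable_S [measurable]: "S N \<in> borel_measurable borel"
  unfolding S_def by measurable

lemma measurable_H [measurable]: "(\<lambda>u. H (exp u)) \<in> borel_measurable borel"
proof (rule borel_measurable_LIMSEQ_real)
  show "(\<lambda>N. S N (exp u)) \<longlonglongrightarrow> H (exp u)" for u
    using H_lim[of "exp u"] by (simp add: S_def)
qed measurable

text \<open>For real \<open>s\<close> the integrals of \<open>S N\<close> are known and converge, so
  monotone convergence gives integrability of \<open>H (exp u) * exp (\<sigma> * u)\<close>. This
  function then dominates, up to sign, for all complex \<open>s\<close> with real part
  \<open>\<sigma>\<close>.\<close>

theorem mellin_H:
  assumes "0 < Re s" "Re s < 1"
  shows "has_bochner_integral lborel (\<lambda>u. of_real (H (exp u)) * exp (s * of_real u)) (K s * (zeta_reg s / (s - 1)))"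
proof -
  have lim: "(\<lambda>N. S N x) \<longlonglongrightarrow> H x" if "x > 0" for x
    using H_lim[OF that] by (simp add: S_def)
  have lim_int: "(\<lambda>N. \<integral>u. of_real (S N (exp u)) * exp (s * of_real u) \<partial>lborel) \<longlonglongrightarrow> K s * (zeta_reg s / (s - 1))"
    if "0 < Re s" "Re s < 1" for s
    unfolding has_bochner_integral_integral_eq[OF mellin_S[OF that]]
    by (intro tendsto_mult tendsto_const zeta_reg_strip_limit that)
  define \<sigma> where "\<sigma> = Re s"
  have \<sigma>: "0 < Re (of_real \<sigma>)" "Re (of_real \<sigma>) < 1" using assms by (auto simp: \<sigma>_def)
  let ?g = "\<lambda>N u. - S N (exp u) * exp (\<sigma> * u)"
  have eq: "of_real (S N (exp u)) * exp (of_real \<sigma> * of_real u) = complex_of_real (S N (exp u) * exp (\<sigma> * u))" for N u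
    by (simp add: exp_of_real[symmetric])
  have int_S: "integrable lborel (\<lambda>u. S N (exp u) * exp (\<sigma> * u))" for N
    using mellin_S[OF \<sigma>, of N] unfolding eq by (simp only: has_bochner_integral_iff complex_of_real_integrable_eq)
  have "(\<lambda>N. Re (\<integral>u. of_real (S N (exp u)) * exp (of_real \<sigma> * of_real u) \<partial>lborel)) \<longlonglongrightarrow> Re (K \<sigma> * (zeta_reg \<sigma> / (of_real \<sigma> - 1)))"
    using tendsto_Re[OF lim_int[OF \<sigma>]] .
  then have lim_real: "(\<lambda>N. \<integral>u. S N (exp u) * exp (\<sigma> * u) \<partial>lborel) \<longlonglongrightarrow> Re (K \<sigma> * (zeta_reg \<sigma> / (of_real \<sigma> - 1)))"
    unfolding eq by (simp only: integral_complex_of_real Re_complex_of_real)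
  have int_H: "integrable lborel (\<lambda>u. - (H (exp u) * exp (\<sigma> * u)))"
  proof (rule integrable_monotone_convergence)
    show "integrable lborel (?g N)" for N using int_S[of N] by simp
    show "AE u in lborel. mono (\<lambda>N. ?g N u)"
      by (intro AE_I2 monoI mult_right_mono) (use S_antimono in \<open>auto simp: monotone_def\<close>)
    show "AE u in lborel. (\<lambda>N. ?g N u) \<longlonglongrightarrow> - (H (exp u) * exp (\<sigma> * u))"
      by (auto intro!: AE_I2 tendsto_minus tendsto_mult lim)
    show "(\<lambda>N. integral\<^sup>L lborel (?g N)) \<longlonglongrightarrow> - Re (K \<sigma> * (zeta_reg \<sigma> / (of_real \<sigma> - 1)))"
      using tendsto_minus[OF lim_real] by simp
  qed measurable
  \<comment> \<open>The sequence starts at \<open>S 0 x = 0\<close>, so every \<open>S N x\<close>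
    lies between \<open>H x\<close> and 0.\<close>
  have S_nonpos: "S N x \<le> 0" if "x > 0" for N x
    using monotoneD[OF S_antimono[OF that], of 0 N] by (simp add: S_def A_0)
  have S_ge: "S N x \<ge> H x" if "x > 0" for N x
    using decseq_ge[OF S_antimono[OF that] lim[OF that]] .
  have bound: "norm (of_real (S N (exp u)) * exp (s * of_real u)) \<le> - (H (exp u) * exp (\<sigma> * u))" for N u
    using S_nonpos[of "exp u" N] S_ge[of "exp u" N] by (simp add: norm_mult \<sigma>_def)
  have conv: "AE u in lborel. (\<lambda>N. of_real (S N (exp u)) * exp (s * of_real u)) \<longlonglongrightarrow> of_real (H (exp u)) * exp (s * of_real u)"
    by (auto intro!: AE_I2 tendsto_intros lim)
  have dc: "integrable lborel (\<lambda>u. of_real (H (exp u)) * exp (s * of_real u))"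
    "(\<lambda>N. \<integral>u. of_real (S N (exp u)) * exp (s * of_real u) \<partial>lborel) \<longlonglongrightarrow> (\<integral>u. of_real (H (exp u)) * exp (s * of_real u) \<partial>lborel)"
    using integrable_dominated_convergence[OF _ _ int_H conv, OF _ _ AE_I2[OF bound]]
      integral_dominated_convergence[OF _ _ int_H conv, OF _ _ AE_I2[OF bound]] by simp_all
  have "(\<integral>u. of_real (H (exp u)) * exp (s * of_real u) \<partial>lborel) = K s * (zeta_reg s / (s - 1))"
    by (rule LIMSEQ_unique[OF dc(2) lim_int[OF assms]])
  then show ?thesis using dc(1) by (simp add: has_bochner_integral_iff)
qed

end

section \<open>The two Muentz kernels\<close>

text \<open>Logarithmic derivative of Euler's reflection formula for
  \<open>Gamma z * Gamma (1 - z)\<close>.\<close>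

lemma Digamma_reflection_complex:
  fixes z :: complex
  assumes "z \<notin> \<int>"
  shows "Digamma z - Digamma (1 - z) = - of_real pi * cos (of_real pi * z) / sin (of_real pi * z)"
proof -
  have nz: "z \<notin> \<int>\<^sub>\<le>\<^sub>0" "1 - z \<notin> \<int>\<^sub>\<le>\<^sub>0"
    using assms nonpos_Ints_Int[of z] nonpos_Ints_Int[of "1 - z"] Ints_diff[of 1 "1 - z"] by auto
  have sin_nz: "sin (of_real pi * z) \<noteq> 0"
    using assms by (auto simp: sin_eq_0 mult.commute)
  have "((\<lambda>w. Gamma w * Gamma (1 - w)) has_field_derivative
      (Gamma z * Digamma z) * Gamma (1 - z) + (Gamma (1 - z) * Digamma (1 - z) * (0 - 1)) * Gamma z) (at z)"
    by (intro DERIV_mult has_field_derivative_Gamma DERIV_chain2[OF has_field_derivative_Gamma] derivative_intros nz)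
  moreover have "((\<lambda>w. of_real pi / sin (of_real pi * w)) has_field_derivative
      - of_real pi * (cos (of_real pi * z) * of_real pi) / (sin (of_real pi * z))^2) (at z)"
    using sin_nz by (auto intro!: derivative_eq_intros simp: power2_eq_square)
  ultimately have "(Gamma z * Digamma z) * Gamma (1 - z) + (Gamma (1 - z) * Digamma (1 - z) * (0 - 1)) * Gamma z
     = - of_real pi * (cos (of_real pi * z) * of_real pi) / (sin (of_real pi * z))^2"
    unfolding Gamma_reflection_complex by (rule DERIV_unique)
  then have "(Gamma z * Gamma (1 - z)) * (Digamma z - Digamma (1 - z))
     = - of_real pi * (cos (of_real pi * z) * of_real pi) / (sin (of_real pi * z))^2"
    by (simp add: algebra_simps)
  then have "(of_real pi / sin (of_real pi * z)) * (Digamma z - Digamma (1 - z))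
     = (of_real pi / sin (of_real pi * z)) * (- of_real pi * cos (of_real pi * z) / sin (of_real pi * z))"
    by (simp add: Gamma_reflection_complex power2_eq_square)
  then show ?thesis using sin_nz by (subst (asm) mult_left_cancel) auto
qed

text \<open>The function phi of the overview.\<close>

definition bose :: "real \<Rightarrow> real" where
  "bose x = 1 / (exp (2 * pi * x) - 1) - 1 / (2 * pi * x)"

lemma measurable_bose [measurable]: "bose \<in> borel_measurable borel"
  unfolding bose_def by measurable

text \<open>The expansion of coth, read off at \<open>z = \<i> * y\<close> from the limit formula
  for \<open>Digamma\<close> on one side and its reflection formula on the other.\<close>

lemma bose_partial_fractions:
  assumes "y > 0"
  shows "(\<lambda>n. y / ((real (Suc n))^2 + y^2)) sums (pi * (bose y + 1 / 2))"
proof -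
  define z where "z = \<i> * of_real y"
  have z: "z \<notin> \<int>" using assms by (auto simp: z_def complex_is_Int_iff)
  have nz: "z + of_nat n \<noteq> 0" "1 - z + of_nat n \<noteq> 0" "of_nat (Suc n) + z \<noteq> 0" "of_nat (Suc n) - z \<noteq> 0" for n
    using assms by (auto simp: z_def complex_eq_iff)
  have z0: "z \<noteq> 0" "1 - z \<noteq> 0" using nz(1)[of 0] nz(2)[of 0] by auto
  \<comment> \<open>Pairing \<open>inverse (1 - z + n)\<close> with
    \<open>inverse (z + (n + 1))\<close> gives the wanted terms. The shift by one index leaves
    \<open>inverse z\<close> at the lower end and \<open>inverse (z + m)\<close>, which tends to 0,
    at the upper end.\<close>
  have part: "(\<Sum>n<m. inverse (1 - z + of_nat n)) - (\<Sum>n<m. inverse (z + of_nat n))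
     = 2 * \<i> * of_real (\<Sum>n<m. y / ((real (Suc n))^2 + y^2)) - inverse z + inverse (z + of_nat m)" for m
  proof (induction m)
    case 0
    then show ?case by simp
  next
    case (Suc m)
    have "of_nat (Suc m) ^ 2 + of_real y ^ 2 = (of_nat (Suc m) - z) * (of_nat (Suc m) + z)"
      by (simp add: z_def power2_eq_square algebra_simps)
    then have "2 * \<i> * of_real (y / ((real (Suc m))^2 + y^2)) = 2 * z / ((of_nat (Suc m) - z) * (of_nat (Suc m) + z))"
      by (simp add: z_def del: of_nat_Suc)
    also have "\<dots> = inverse (of_nat (Suc m) - z) - inverse (of_nat (Suc m) + z)"
      using nz(3)[of m] nz(4)[of m] by (simp add: field_simps del: of_nat_Suc)
    finally have step: "2 * \<i> * of_real (y / ((real (Suc m))^2 + y^2)) = inverse (of_nat (Suc m) - z) - inverse (of_nat (Suc m) + z)" .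
    have e: "1 - z + of_nat m = of_nat (Suc m) - z" "z + of_nat (Suc m) = of_nat (Suc m) + z" by simp_all
    have alg: "P - Q = X - w + c \<Longrightarrow> (P + a) - (Q + c) = (X + (a - b)) - w + b" for P Q X w a b c :: complex
      by (simp add: algebra_simps)
    show ?case
      unfolding sum.lessThan_Suc of_real_add distrib_left step e by (rule alg[OF Suc.IH])
  qed
  \<comment> \<open>The logarithms in the two limits cancel.\<close>
  have "(\<lambda>m. (of_real (ln (real m)) - (\<Sum>n<m. inverse (z + of_nat n))) -
       (of_real (ln (real m)) - (\<Sum>n<m. inverse (1 - z + of_nat n)))) \<longlonglongrightarrow> Digamma z - Digamma (1 - z)"
    by (intro tendsto_diff Digamma_LIMSEQ z0)
  then have "(\<lambda>m. 2 * \<i> * of_real (\<Sum>n<m. y / ((real (Suc n))^2 + y^2)) - inverse z + inverse (z + of_nat m))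
      \<longlonglongrightarrow> Digamma z - Digamma (1 - z)"
    unfolding part[symmetric] by (simp add: algebra_simps)
  moreover have "(\<lambda>m. inverse (z + of_nat m)) \<longlonglongrightarrow> 0"
    by (intro tendsto_inverse_0[THEN filterlim_compose] tendsto_add_filterlim_at_infinity[OF tendsto_const]
        tendsto_of_nat)
  ultimately have "(\<lambda>m. ((2 * \<i> * of_real (\<Sum>n<m. y / ((real (Suc n))^2 + y^2)) - inverse z + inverse (z + of_nat m))
       - inverse (z + of_nat m) + inverse z) / (2 * \<i>))
      \<longlonglongrightarrow> ((Digamma z - Digamma (1 - z)) - 0 + inverse z) / (2 * \<i>)"
    by (intro tendsto_intros) auto
  then have "(\<lambda>m. complex_of_real (\<Sum>n<m. y / ((real (Suc n))^2 + y^2)))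
      \<longlonglongrightarrow> ((Digamma z - Digamma (1 - z)) + inverse z) / (2 * \<i>)"
    by simp
  also have "((Digamma z - Digamma (1 - z)) + inverse z) / (2 * \<i>) = of_real (pi * (bose y + 1 / 2))"
  proof -
    define E where "E = exp (pi * y)"
    have E: "E > 1" using assms by (simp add: E_def)
    then have E2: "E * E \<noteq> 1" by (metis less_1_mult less_irrefl)
    have iz: "\<i> * (of_real pi * z) = of_real (- (pi * y))"
      by (simp add: z_def complex_eq_iff)
    have e: "exp (\<i> * (of_real pi * z)) = of_real (inverse E)" "exp (- (\<i> * (of_real pi * z))) = of_real E"
      unfolding iz by (simp_all add: E_def exp_minus exp_of_real flip: of_real_mult)
    have quot: "- q * (c / 2) / (\<i> * d / 2) = \<i> * (q * (c / d))" for q c d :: complex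
    proof -
      have "q * c / (\<i> * d) = 1 / \<i> * (q * c / d)" by (simp only: times_divide_times_eq mult_1)
      also have "1 / \<i> = - \<i>" by simp
      finally show ?thesis by simp
    qed
    have "- of_real pi * cos (of_real pi * z) / sin (of_real pi * z) = \<i> * of_real (pi * ((E + inverse E) / (E - inverse E)))"
    proof -
      have c: "cos (of_real pi * z) = of_real (E + inverse E) / 2"
        by (simp only: cos_exp_eq[of "of_real pi * z"] e of_real_add add.commute)
      have s: "sin (of_real pi * z) = \<i> * of_real (E - inverse E) / 2"
        by (simp only: sin_exp_eq'[of "of_real pi * z"] e of_real_diff)
      show ?thesis unfolding c s of_real_mult of_real_divide by (rule quot)
    qed
    also have "(E + inverse E) / (E - inverse E) = 1 + 2 / (E * E - 1)"
      using E E2 by (simp add: divide_simps)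
    also have "E * E = exp (2 * pi * y)"
      by (simp add: E_def flip: exp_add)
    finally have "Digamma z - Digamma (1 - z) = \<i> * of_real (pi * (1 + 2 / (exp (2 * pi * y) - 1)))"
      by (simp add: Digamma_reflection_complex[OF z])
    moreover have "inverse z = - \<i> * of_real (1 / y)"
      using assms by (simp add: z_def field_simps)
    moreover have "(\<i> * of_real p + - \<i> * of_real q) / (2 * \<i>) = complex_of_real ((p - q) / 2)" for p q
      by (simp add: algebra_simps diff_divide_distrib)
    ultimately have "((Digamma z - Digamma (1 - z)) + inverse z) / (2 * \<i>)
        = of_real ((pi * (1 + 2 / (exp (2 * pi * y) - 1)) - 1 / y) / 2)"
      by (simp only:)
    also have "(pi * (1 + 2 / (exp (2 * pi * y) - 1)) - 1 / y) / 2 = pi * (bose y + 1 / 2)"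
    proof -
      have "(pi * (1 + 2 * q) - 1 / y) / 2 = pi * (q - 1 / (2 * pi * y) + 1 / 2)" for q
        using assms by (simp add: field_simps)
      from this[of "1 / (exp (2 * pi * y) - 1)"] show ?thesis by (simp add: bose_def)
    qed
    finally show ?thesis .
  qed
  finally show ?thesis
    unfolding sums_def tendsto_of_real_iff .
qed

text \<open>With \<open>q = exp (- 2 * pi * x)\<close>, the geometric sum and the truncated integral
  both carry the factor \<open>1 - q ^ N\<close>, so the approximant equals
  \<open>(1 - q ^ N) * bose x\<close>.\<close>

lemma muentz_bose: "muentz (\<lambda>x. exp (- 2 * pi * x)) (\<lambda>x. (1 - exp (- 2 * pi * x)) / (2 * pi)) bose (1 / (2 * pi))"
proof
  show "((\<lambda>x. (1 - exp (- 2 * pi * x)) / (2 * pi)) has_real_derivative exp (- 2 * pi * x)) (at x)" for x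
    by (auto intro!: derivative_eq_intros)
  show "continuous_on UNIV (\<lambda>x. exp (- 2 * pi * x))" by (intro continuous_intros)
  show "(1 - exp (- 2 * pi * x)) / (2 * pi) \<le> 1 / (2 * pi)" for x by (simp add: divide_right_mono)
  fix x :: real assume x: "x > 0"
  define q where "q = exp (- 2 * pi * x)"
  have q: "0 < q" "q < 1" using x by (simp_all add: q_def)
  have qn: "exp (- 2 * pi * (real n * x)) = q ^ n" for n
    unfolding q_def exp_of_nat_mult[symmetric] by (simp add: mult_ac)
  have "bose x = q / (1 - q) - 1 / (2 * pi * x)"
    using q by (simp add: bose_def q_def exp_minus field_simps)
  then have "(\<Sum>n<N. q ^ Suc n) - (1 - q ^ N) / (2 * pi) / x = (1 - q ^ N) * bose x" for N
  proof -
    have "(\<Sum>n<N. q ^ Suc n) = q * (\<Sum>n<N. q ^ n)" by (simp add: sum_distrib_left)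
    also have "\<dots> = q * ((1 - q ^ N) / (1 - q))" using q by (simp add: sum_gp_strict)
    also have "\<dots> = (1 - q ^ N) * (q / (1 - q))" by simp
    finally show ?thesis unfolding \<open>bose x = _\<close> right_diff_distrib by simp
  qed
  moreover have "(\<lambda>N. (1 - q ^ N) * bose x) \<longlonglongrightarrow> (1 - 0) * bose x"
    using q by (intro tendsto_intros LIMSEQ_realpow_zero) auto
  ultimately show "(\<lambda>N. (\<Sum>n<N. exp (- 2 * pi * (real (Suc n) * x))) - (1 - exp (- 2 * pi * (real N * x))) / (2 * pi) / x) \<longlonglongrightarrow> bose x"
    unfolding qn by simp
qed auto

text \<open>The partial fractions are taken at \<open>y = 1 / x\<close>; their constant
  \<open>pi / 2\<close> is cancelled by the limit of \<open>arctan\<close>.\<close>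

lemma muentz_arctan: "muentz (\<lambda>x. 1 / (1 + x^2)) arctan (\<lambda>x. pi / x * bose (1 / x)) (pi / 2)"
proof
  show "(arctan has_real_derivative 1 / (1 + x^2)) (at x)" for x
    by (auto intro!: derivative_eq_intros simp: field_simps)
  show "continuous_on UNIV (\<lambda>x::real. 1 / (1 + x^2))"
    by (intro continuous_intros) (auto simp: add_nonneg_eq_0_iff)
  show "arctan x \<le> pi / 2" for x using arctan_ubound[of x] by simp
  show "1 / (1 + y^2) \<le> 1 / (1 + x^2)" if "0 \<le> x" "x \<le> y" for x y :: real
    using that by (intro divide_left_mono add_left_mono power_mono) (auto intro!: add_pos_nonneg mult_pos_pos)
  fix x :: real assume x: "x > 0"
  have "(\<lambda>n. 1 / x * (1 / x / ((real (Suc n))^2 + (1 / x)^2))) sums (1 / x * (pi * (bose (1 / x) + 1 / 2)))"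
    using bose_partial_fractions[of "1 / x"] x by (intro sums_mult) auto
  also have "(\<lambda>n. 1 / x * (1 / x / ((real (Suc n))^2 + (1 / x)^2))) = (\<lambda>n. 1 / (1 + (real (Suc n) * x)^2))"
    using x by (intro ext) (simp add: field_simps power2_eq_square del: of_nat_Suc)
  finally have 1: "(\<lambda>N. \<Sum>n<N. 1 / (1 + (real (Suc n) * x)^2)) \<longlonglongrightarrow> 1 / x * (pi * (bose (1 / x) + 1 / 2))"
    by (simp only: sums_def)
  have 2: "(\<lambda>N. arctan (real N * x) / x) \<longlonglongrightarrow> (pi / 2) / x"
    using x by (intro tendsto_divide tendsto_const filterlim_compose[OF tendsto_arctan_at_top]
       filterlim_at_top_mult_tendsto_pos[OF tendsto_const _ filterlim_real_sequentially]) auto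
  show "(\<lambda>N. (\<Sum>n<N. 1 / (1 + (real (Suc n) * x)^2)) - arctan (real N * x) / x) \<longlonglongrightarrow> pi / x * bose (1 / x)"
    using tendsto_diff[OF 1 2] x by (simp add: algebra_simps)
qed auto

section \<open>Mellin transforms of the two kernels\<close>

lemma mellin_exp:
  assumes "Re s > 0" "c > 0"
  shows "has_bochner_integral lborel (\<lambda>u. of_real (exp (- c * exp u)) * exp (s * of_real u)) (of_real c powr (- s) * Gamma s)"
  using mellin_scale[where f = "\<lambda>x. of_real (exp (- x))" and s = s and c = c and I = "Gamma s"] Gamma_integral_exp[OF assms(1)] assms(2)
  by (simp add: mult.commute)

text \<open>
  Both sides are the double integral of \<open>exp (w * v + b - exp b * (1 + exp v))\<close>, evaluated in the
  two orders.
\<close>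

lemma integral_logistic_kernel:
  assumes "0 < Re w" "Re w < 1"
  shows "has_bochner_integral lborel (\<lambda>v. exp (w * of_real v) / of_real (1 + exp v)) (Gamma w * Gamma (1 - w))"
proof -
  define f where "f = (\<lambda>w b v. exp (w * of_real v) * exp (of_real b) * complex_of_real (exp (- exp b * (1 + exp v))))"
  have f_v: "has_bochner_integral lborel (f w b) (exp ((1 - w) * of_real b) * of_real (exp (- exp b)) * Gamma w)"
    if "Re w > 0" for w b
  proof -
    have "has_bochner_integral lborel (\<lambda>v. (exp (of_real b) * of_real (exp (- exp b))) * (of_real (exp (- exp b * exp v)) * exp (w * of_real v)))
      ((exp (of_real b) * of_real (exp (- exp b))) * (of_real (exp b) powr (- w) * Gamma w))"
      by (intro has_bochner_integral_mult_right mellin_exp that) auto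
    also have "(\<lambda>v. (exp (of_real b) * of_real (exp (- exp b))) * (of_real (exp (- exp b * exp v)) * exp (w * of_real v))) = f w b"
      by (auto simp: f_def fun_eq_iff ring_distribs exp_diff exp_minus field_simps)
    also have "(exp (of_real b) * of_real (exp (- exp b))) * (of_real (exp b) powr (- w) * Gamma w)
       = exp ((1 - w) * of_real b) * of_real (exp (- exp b)) * Gamma w"
      by (simp add: powr_def Ln_of_real left_diff_distrib exp_diff exp_minus field_simps)
    finally show ?thesis .
  qed
  have f_b: "has_bochner_integral lborel (\<lambda>b. f w b v) (exp (w * of_real v) / of_real (1 + exp v))" for v
  proof -
    have c: "0 < 1 + exp v" by (simp add: add_pos_pos)
    have "has_bochner_integral lborel (\<lambda>b. exp (w * of_real v) * (of_real (exp (- (1 + exp v) * exp b)) * exp (1 * of_real b)))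
       (exp (w * of_real v) * (of_real (1 + exp v) powr (- 1) * Gamma 1))"
      by (intro has_bochner_integral_mult_right mellin_exp c) auto
    also have "(\<lambda>b. exp (w * of_real v) * (of_real (exp (- (1 + exp v) * exp b)) * exp (1 * of_real b))) = (\<lambda>b. f w b v)"
      by (auto simp: f_def fun_eq_iff algebra_simps)
    also have "exp (w * of_real v) * (of_real (1 + exp v) powr (- 1) * Gamma 1) = exp (w * of_real v) / of_real (1 + exp v)"
      using c by (simp add: powr_minus divide_inverse)
    finally show ?thesis .
  qed
  have meas: "(\<lambda>(b, v). f w b v) \<in> borel_measurable (lborel \<Otimes>\<^sub>M lborel)"
    unfolding f_def by measurable
  \<comment> \<open>Passing to norms replaces \<open>w\<close> by its real part, so the absolute
    integrals are evaluated by the same two formulas; \<open>0 < Re w\<close> and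
    \<open>Re w < 1\<close> make both available.\<close>
  have nf: "norm (f w b v) = Re (f (of_real (Re w)) b v)" for b v
    by (simp add: f_def norm_mult exp_of_real flip: of_real_mult)
  have int: "integrable (lborel \<Otimes>\<^sub>M lborel) (\<lambda>(b, v). f w b v)"
  proof (rule lborel_pair.Fubini_integrable[OF meas])
    have "(\<integral>v. norm (f w b v) \<partial>lborel) = Re (exp ((1 - of_real (Re w)) * of_real b) * of_real (exp (- exp b)) * Gamma (of_real (Re w)))" for b
      unfolding nf using f_v[of "of_real (Re w)" b] assms(1) by (subst integral_Re) (auto simp: has_bochner_integral_iff)
    moreover have "integrable lborel (\<lambda>b. exp ((1 - of_real (Re w)) * of_real b) * of_real (exp (- exp b)) * Gamma (complex_of_real (Re w)))"
      using Gamma_integral_exp[of "1 - of_real (Re w)"] assms(2) by (simp add: has_bochner_integral_iff)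
    ultimately show "integrable lborel (\<lambda>x. \<integral>y. norm (case (x, y) of (b, v) \<Rightarrow> f w b v) \<partial>lborel)"
      by (simp only: prod.case integrable_Re)
    show "AE x in lborel. integrable lborel (\<lambda>y. case (x, y) of (b, v) \<Rightarrow> f w b v)"
      using f_v[OF assms(1)] by (simp add: has_bochner_integral_iff)
  qed
  have "(\<integral>v. (\<integral>b. f w b v \<partial>lborel) \<partial>lborel) = (\<integral>b. (\<integral>v. f w b v \<partial>lborel) \<partial>lborel)"
    by (rule lborel_pair.Fubini_integral[OF int])
  also have "\<dots> = (\<integral>b. exp ((1 - w) * of_real b) * of_real (exp (- exp b)) \<partial>lborel) * Gamma w"
    by (simp only: has_bochner_integral_integral_eq[OF f_v[OF assms(1)]] integral_mult_left_zero)
  also have "\<dots> = Gamma w * Gamma (1 - w)"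
    using has_bochner_integral_integral_eq[OF Gamma_integral_exp[of "1 - w"]] assms(2) by simp
  finally have "(\<integral>v. exp (w * of_real v) / of_real (1 + exp v) \<partial>lborel) = Gamma w * Gamma (1 - w)"
    by (simp only: has_bochner_integral_integral_eq[OF f_b])
  moreover have "integrable lborel (\<lambda>v. exp (w * of_real v) / complex_of_real (1 + exp v))"
    using lborel_pair.integrable_snd[OF int] by (simp only: has_bochner_integral_integral_eq[OF f_b])
  ultimately show ?thesis by (simp add: has_bochner_integral_iff)
qed

section \<open>The functional equation and the Riemann xi function\<close>

lemma integral_double:
  fixes f :: "real \<Rightarrow> complex"
  assumes "has_bochner_integral lborel f I"
  shows "has_bochner_integral lborel (\<lambda>u. f (2 * u)) (I / 2)"
  using assms by (subst (asm) lborel_has_bochner_integral_real_affine_iff[where c = 2 and t = 0])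
    (simp_all add: scaleR_conv_of_real)

lemma integral_reflect:
  fixes f :: "real \<Rightarrow> complex"
  assumes "has_bochner_integral lborel f I"
  shows "has_bochner_integral lborel (\<lambda>u. f (- u)) I"
  using assms by (subst (asm) lborel_has_bochner_integral_real_affine_iff[where c = "-1" and t = 0]) simp_all

lemma mellin_bose:
  assumes "0 < Re s" "Re s < 1"
  shows "has_bochner_integral lborel (\<lambda>u. of_real (bose (exp u)) * exp (s * of_real u))
     (of_real (2 * pi) powr (- s) * Gamma s * (zeta_reg s / (s - 1)))"
proof -
  interpret muentz "\<lambda>x. exp (- 2 * pi * x)" "\<lambda>x. (1 - exp (- 2 * pi * x)) / (2 * pi)" bose "1 / (2 * pi)"
    by (rule muentz_bose)
  have "K s = of_real (2 * pi) powr (- s) * Gamma s"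
    unfolding K_def using has_bochner_integral_integral_eq[OF mellin_exp[OF assms(1), of "2 * pi"]] by simp
  then show ?thesis using mellin_H[OF assms] by simp
qed

text \<open>In the formula for the second kernel, replacing \<open>u\<close> by \<open>- u\<close>
  moves the exponent from \<open>s\<close> to \<open>1 - s\<close>, while zeta keeps the argument
  \<open>s\<close>. Together with \<open>mellin_bose\<close> at \<open>1 - s\<close>, this is the
  functional equation in disguise.\<close>

lemma mellin_bose_reflected:
  assumes "0 < Re s" "Re s < 1"
  shows "has_bochner_integral lborel (\<lambda>u. of_real (bose (exp u)) * exp ((1 - s) * of_real u))
     (Gamma (s / 2) * Gamma (1 - s / 2) / (2 * of_real pi) * (zeta_reg s / (s - 1)))"
proof -
  interpret muentz "\<lambda>x. 1 / (1 + x^2)" arctan "\<lambda>x. pi / x * bose (1 / x)" "pi / 2"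
    by (rule muentz_arctan)
  have s2: "0 < Re (s / 2)" "Re (s / 2) < 1" using assms by simp_all
  have "has_bochner_integral lborel (\<lambda>u. exp (s / 2 * of_real (2 * u)) / of_real (1 + exp (2 * u))) (Gamma (s / 2) * Gamma (1 - s / 2) / 2)"
    by (rule integral_double[OF integral_logistic_kernel[OF s2]])
  also have "(\<lambda>u. exp (s / 2 * of_real (2 * u)) / of_real (1 + exp (2 * u))) = (\<lambda>u. of_real (1 / (1 + (exp u)^2)) * exp (s * of_real u))"
    by (auto simp: fun_eq_iff exp_double)
  finally have "K s = Gamma (s / 2) * Gamma (1 - s / 2) / 2"
    unfolding K_def by (rule has_bochner_integral_integral_eq)
  then have "has_bochner_integral lborel (\<lambda>u. of_real (pi / exp u * bose (1 / exp u)) * exp (s * of_real u))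
       (Gamma (s / 2) * Gamma (1 - s / 2) / 2 * (zeta_reg s / (s - 1)))"
    using mellin_H[OF assms] by (simp only:)
  from integral_reflect[OF this]
  have "has_bochner_integral lborel (\<lambda>u. 1 / of_real pi * (of_real (pi / exp (- u) * bose (1 / exp (- u))) * exp (s * of_real (- u))))
       (1 / of_real pi * (Gamma (s / 2) * Gamma (1 - s / 2) / 2 * (zeta_reg s / (s - 1))))"
    by (rule has_bochner_integral_mult_right)
  also have "(\<lambda>u. 1 / of_real pi * (of_real (pi / exp (- u) * bose (1 / exp (- u))) * exp (s * of_real (- u))))
      = (\<lambda>u. of_real (bose (exp u)) * exp ((1 - s) * of_real u))"
    by (auto simp: fun_eq_iff exp_minus left_diff_distrib exp_diff exp_of_real[symmetric] field_simps)
  also have "1 / of_real pi * (Gamma (s / 2) * Gamma (1 - s / 2) / 2 * (zeta_reg s / (s - 1)))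
      = Gamma (s / 2) * Gamma (1 - s / 2) / (2 * of_real pi) * (zeta_reg s / (s - 1))"
    by simp
  finally show ?thesis .
qed

text \<open>
  This is \<open>\<xi>(s)\<close> for \<open>Re s > 0\<close>, including \<open>s = 1\<close>, as \<open>s / 2 * Gamma (s / 2) = Gamma (1 + s / 2)\<close>
  and \<open>zeta_reg s = (s - 1) \<zeta>(s)\<close>.
\<close>

definition xi_half :: "complex \<Rightarrow> complex" where
  "xi_half s = of_real pi powr (- s / 2) * Gamma (1 + s / 2) * zeta_reg s"

lemma Re_pos_not_nonpos_Int: "Re s > 0 \<Longrightarrow> s \<notin> \<int>\<^sub>\<le>\<^sub>0"
  by (auto elim!: nonpos_Ints_cases)

lemma xi_half_holomorphic: "xi_half holomorphic_on {s. Re s > 0}"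
  unfolding xi_half_def
proof (intro holomorphic_intros zeta_reg_holomorphic)
  fix s assume "s \<in> {s. Re s > 0}"
  then show "1 + s / 2 \<notin> \<int>\<^sub>\<le>\<^sub>0" by (intro Re_pos_not_nonpos_Int) simp
qed auto

lemma Gamma_nonzero_Re_pos: "Re s > 0 \<Longrightarrow> Gamma s \<noteq> 0"
  using Re_pos_not_nonpos_Int by (simp add: Gamma_eq_zero_iff)

lemma Gamma_half_plus1: "Re s > 0 \<Longrightarrow> Gamma (1 + s / 2) = s / 2 * Gamma (s / 2)"
  using Gamma_plus1[OF Re_pos_not_nonpos_Int, of "s / 2"] by (simp add: add.commute)

text \<open>The two evaluations of the transform of \<open>bose\<close> at \<open>1 - s\<close> are
  equated. Legendre's duplication formula at \<open>(1 - s) / 2\<close> replaces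
  \<open>Gamma (1 - s)\<close> and frees the common factor \<open>Gamma (1 - s / 2)\<close>; what
  remains is bookkeeping of powers of 2 and pi.\<close>

lemma xi_half_reflect:
  assumes "0 < Re s" "Re s < 1"
  shows "xi_half (1 - s) = xi_half s"
proof -
  define Z where "Z = (\<lambda>s. zeta_reg s / (s - 1))"
  have s: "s \<noteq> 0" "s \<noteq> 1" using assms by auto
  define p where "p = (\<lambda>w. exp (w * complex_of_real (ln pi)))"
  have p: "of_real pi powr w = p w" for w
    by (simp add: p_def powr_def Ln_of_real)
  have p_add: "p (v + w) = p v * p w" for v w by (simp add: p_def ring_distribs exp_add)
  have p_nz: "p w \<noteq> 0" for w by (simp add: p_def)
  have p1: "p 1 = of_real pi" by (simp add: p_def exp_of_real)
  have p_half: "p (1 / 2) = of_real (sqrt pi)"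
    by (simp add: p_def powr_half_sqrt[symmetric] powr_def exp_of_real[symmetric])
  have two: "of_real (2 * pi) powr w = exp (w * of_real (ln 2)) * p w" for w
    by (simp add: p_def powr_def Ln_of_real ln_mult ring_distribs exp_add del: of_real_mult)
  have "(\<integral>u. of_real (bose (exp u)) * exp ((1 - s) * of_real u) \<partial>lborel) =
      Gamma (s / 2) * Gamma (1 - s / 2) / (2 * of_real pi) * Z s"
    unfolding Z_def by (rule has_bochner_integral_integral_eq[OF mellin_bose_reflected[OF assms]])
  moreover have "(\<integral>u. of_real (bose (exp u)) * exp ((1 - s) * of_real u) \<partial>lborel) =
      of_real (2 * pi) powr (- (1 - s)) * Gamma (1 - s) * Z (1 - s)"
    unfolding Z_def by (rule has_bochner_integral_integral_eq[OF mellin_bose]) (use assms in auto)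
  ultimately have eq1: "Gamma (s / 2) * Gamma (1 - s / 2) / (2 * of_real pi) * Z s
     = of_real (2 * pi) powr (- (1 - s)) * Gamma (1 - s) * Z (1 - s)" by simp
  have "Gamma ((1 - s) / 2) * Gamma ((1 - s) / 2 + 1 / 2) = exp ((1 - 2 * ((1 - s) / 2)) * of_real (ln 2)) * of_real (sqrt pi) * Gamma (2 * ((1 - s) / 2))"
  proof (rule Gamma_legendre_duplication)
    show "(1 - s) / 2 \<notin> \<int>\<^sub>\<le>\<^sub>0" "(1 - s) / 2 + 1 / 2 \<notin> \<int>\<^sub>\<le>\<^sub>0"
      using assms by (auto intro!: Re_pos_not_nonpos_Int add_pos_pos)
  qed
  moreover have "(1 - s) / 2 + 1 / 2 = 1 - s / 2" "1 - 2 * ((1 - s) / 2) = s" "2 * ((1 - s) / 2) = 1 - s"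
    by (simp_all add: field_simps)
  ultimately have dup: "Gamma ((1 - s) / 2) * Gamma (1 - s / 2) = exp (s * of_real (ln 2)) * p (1 / 2) * Gamma (1 - s)"
    by (simp only: p_half)
  have "exp (s * of_real (ln 2)) * p (1 / 2) * (Gamma (s / 2) * Gamma (1 - s / 2) / (2 * of_real pi) * Z s)
    = of_real (2 * pi) powr (- (1 - s)) * Z (1 - s) * (exp (s * of_real (ln 2)) * p (1 / 2) * Gamma (1 - s))"
    unfolding eq1 by simp
  also have "\<dots> = of_real (2 * pi) powr (- (1 - s)) * Z (1 - s) * (Gamma ((1 - s) / 2) * Gamma (1 - s / 2))"
    by (simp only: dup)
  finally have eq2: "Gamma (1 - s / 2) * (exp (s * of_real (ln 2)) * p (1 / 2) * (Gamma (s / 2) / (2 * of_real pi) * Z s))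
    = Gamma (1 - s / 2) * (of_real (2 * pi) powr (- (1 - s)) * Z (1 - s) * Gamma ((1 - s) / 2))"
    by (simp add: mult_ac)
  have "Gamma (1 - s / 2) \<noteq> 0" using assms by (intro Gamma_nonzero_Re_pos) auto
  with eq2 have "exp (s * of_real (ln 2)) * p (1 / 2) * (Gamma (s / 2) / (2 * of_real pi) * Z s)
      = of_real (2 * pi) powr (- (1 - s)) * Z (1 - s) * Gamma ((1 - s) / 2)"
    by (subst (asm) mult_left_cancel) auto
  also have "of_real (2 * pi) powr (- (1 - s)) = exp (s * of_real (ln 2)) / 2 * p (s - 1)"
    unfolding two by (simp add: left_diff_distrib exp_diff exp_of_real)
  finally have "exp (s * of_real (ln 2)) * (p (1 / 2) * Gamma (s / 2) * Z s)
     = exp (s * of_real (ln 2)) * (of_real pi * p (s - 1) * Z (1 - s) * Gamma ((1 - s) / 2))"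
    by (simp add: field_simps)
  then have eq3: "p (1 / 2) * Gamma (s / 2) * Z s = p 1 * p (s - 1) * Z (1 - s) * Gamma ((1 - s) / 2)"
    by (subst (asm) mult_left_cancel) (auto simp: p1)
  have xi: "xi_half w = w * (w - 1) / 2 * (p (- w / 2) * Gamma (w / 2) * Z w)" if "0 < Re w" "Re w < 1" for w
  proof -
    have "w \<noteq> 1" using that by auto
    then have "zeta_reg w = (w - 1) * Z w" by (simp add: Z_def)
    then show ?thesis using that by (simp add: xi_half_def p Gamma_half_plus1)
  qed
  have "p (s - 1) * p 1 = p s" by (simp flip: p_add)
  then have eq4: "p (1 / 2) * Gamma (s / 2) * Z s = p s * (Z (1 - s) * Gamma ((1 - s) / 2))"
    using eq3 by (simp add: mult_ac)
  have "p (1 / 2) * p (s / 2) * (p (- s / 2) * Gamma (s / 2) * Z s) = (p (s / 2) * p (- s / 2)) * (p (1 / 2) * Gamma (s / 2) * Z s)"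
    by (simp add: mult_ac)
  also have "\<dots> = (p (s / 2) * p (- s / 2)) * (p s * (Z (1 - s) * Gamma ((1 - s) / 2)))"
    by (simp only: eq4)
  also have "p (s / 2) * p (- s / 2) = 1" by (simp flip: p_add) (simp add: p_def)
  also have "p s = p (1 / 2) * p (s / 2) * p (- (1 - s) / 2)" by (simp flip: p_add add: field_simps)
  finally have "p (1 / 2) * p (s / 2) * (p (- s / 2) * Gamma (s / 2) * Z s)
     = p (1 / 2) * p (s / 2) * (p (- (1 - s) / 2) * Gamma ((1 - s) / 2) * Z (1 - s))"
    by (simp add: mult_ac)
  then have "p (- s / 2) * Gamma (s / 2) * Z s = p (- (1 - s) / 2) * Gamma ((1 - s) / 2) * Z (1 - s)"
    by (subst (asm) mult_left_cancel) (auto simp: p_nz)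
  moreover have "(1 - s) * (1 - s - 1) / 2 = s * (s - 1) / 2" by (simp add: algebra_simps)
  ultimately show ?thesis
    using assms xi[of s] xi[of "1 - s"] by (simp only: minus_complex.sel one_complex.sel)
qed

text \<open>The last branch solves the reflected equation for zeta. Writing it with the entire
  function \<open>rGamma\<close> avoids the poles of \<open>Gamma (1 + s / 2)\<close> at -2, -4,
  ..., which become the trivial zeros.\<close>

definition zeta_glued :: "complex \<Rightarrow> complex" where
  "zeta_glued s = (if s = 1 then 0 else if Re s > 0 then zeta_reg s / (s - 1)
     else of_real pi powr (s / 2) * rGamma (1 + s / 2) * xi_half (1 - s) / (s - 1))"

lemma zeta_glued_holomorphic: "zeta_glued holomorphic_on - {1}"
proof -
  define A where "A = {s. Re s > 0} - {1}"
  define B where "B = {s. Re s < 1}"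
  have "open A" unfolding A_def by (intro open_Diff open_halfspace_Re_gt) auto
  have "open B" unfolding B_def by (rule open_halfspace_Re_lt)
  have "(\<lambda>s. zeta_reg s / (s - 1)) holomorphic_on A"
    unfolding A_def by (intro holomorphic_intros holomorphic_on_subset[OF zeta_reg_holomorphic]) auto
  then have "zeta_glued holomorphic_on A"
    by (rule holomorphic_transform) (auto simp: zeta_glued_def A_def)
  have "(\<lambda>s. xi_half (1 - s)) holomorphic_on B"
    by (rule holomorphic_on_compose_gen[OF _ xi_half_holomorphic, unfolded o_def])
       (auto simp: B_def intro!: holomorphic_intros)
  then have "(\<lambda>s. of_real pi powr (s / 2) * rGamma (1 + s / 2) * xi_half (1 - s) / (s - 1)) holomorphic_on B"
    by (intro holomorphic_intros) (auto simp: B_def)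
  then have "zeta_glued holomorphic_on B"
  proof (rule holomorphic_transform)
    fix s assume "s \<in> B"
    then have s: "Re s < 1" by (simp add: B_def)
    show "of_real pi powr (s / 2) * rGamma (1 + s / 2) * xi_half (1 - s) / (s - 1) = zeta_glued s"
    proof (cases "Re s > 0")
      case True
      have "rGamma (1 + s / 2) * Gamma (1 + s / 2) = 1"
        using Gamma_nonzero_Re_pos[of "1 + s / 2"] True by (simp add: rGamma_inverse_Gamma)
      moreover have "of_real pi powr (s / 2) * of_real pi powr (- s / 2) = 1"
        by (simp flip: powr_add)
      ultimately have "(of_real pi powr (s / 2) * of_real pi powr (- s / 2)) * (rGamma (1 + s / 2) * Gamma (1 + s / 2)) * zeta_reg s = zeta_reg s"
        by simp
      then have "of_real pi powr (s / 2) * rGamma (1 + s / 2) * xi_half s = zeta_reg s"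
        unfolding xi_half_def by (simp only: mult_ac)
      then show ?thesis
        using True s by (auto simp: zeta_glued_def xi_half_reflect)
    qed (use s in \<open>auto simp: zeta_glued_def\<close>)
  qed
  have "A \<union> B = - {1}" by (force simp: A_def B_def)
  with holomorphic_on_Un[OF \<open>zeta_glued holomorphic_on A\<close> \<open>zeta_glued holomorphic_on B\<close> \<open>open A\<close> \<open>open B\<close>]
  show ?thesis by simp
qed

text \<open>The glued function is the existence proof that the definite description requires;
  uniqueness is analytic continuation from \<open>Re s > 1\<close> through the connected punctured
  plane.\<close>

lemma riemann_zeta_eq_glued: "riemann_zeta = zeta_glued"
  unfolding riemann_zeta_def
proof (rule the_equality)
  show *: "zeta_glued holomorphic_on - {1} \<and> zeta_glued 1 = 0 \<and>
     (\<forall>s. Re s > 1 \<longrightarrow> (\<lambda>n. 1 / of_nat (Suc n) powr s) sums zeta_glued s)"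
  proof (intro conjI allI impI zeta_glued_holomorphic)
    fix s :: complex assume "Re s > 1"
    moreover from this have "s \<noteq> 1" by auto
    ultimately show "(\<lambda>n. 1 / of_nat (Suc n) powr s) sums zeta_glued s"
      using zeta_reg_dirichlet[of s] by (simp add: zeta_glued_def)
  qed (simp add: zeta_glued_def)
  fix f assume f: "f holomorphic_on - {1} \<and> f 1 = 0 \<and>
     (\<forall>s. Re s > 1 \<longrightarrow> (\<lambda>n. 1 / of_nat (Suc n) powr s) sums f s)"
  show "f = zeta_glued"
  proof
    fix s
    show "f s = zeta_glued s"
    proof (cases "s = 1")
      case False
      show ?thesis
      proof (rule analytic_continuation_open[of "{s. Re s > 1}" "- {1}" f zeta_glued])
        show "open {s. Re s > 1}" by (rule open_halfspace_Re_gt)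
        show "connected (- {1::complex})" by (rule connected_punctured_universe) simp
        have "(2::complex) \<in> {s. Re s > 1}" by simp
        then show "{s. Re s > 1} \<noteq> {}" by blast
        show "f z = zeta_glued z" if "z \<in> {s. Re s > 1}" for z
          using f * that sums_unique2 by blast
      qed (use f zeta_glued_holomorphic False in auto)
    qed (use f in \<open>simp add: zeta_glued_def\<close>)
  qed
qed

text \<open>Inside the strip the defining product is already holomorphic, so
  \<open>remove_sings\<close> leaves it unchanged; the critical line lies inside.\<close>

lemma riemann_xi_strip:
  assumes "0 < Re s" "Re s < 1"
  shows "riemann_xi s = xi_half s"
proof -
  define f where "f = (\<lambda>s. 1 / 2 * s * (s - 1) * of_real pi powr (- s / 2) * Gamma (s / 2) * riemann_zeta s)"
  have eq: "f s = xi_half s" if "0 < Re s" "Re s < 1" for s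
    using that by (auto simp: f_def xi_half_def Gamma_half_plus1 riemann_zeta_eq_glued zeta_glued_def)
  have open_strip: "open {s. 0 < Re s \<and> Re s < 1}"
    unfolding Collect_conj_eq by (intro open_Int open_halfspace_Re_gt open_halfspace_Re_lt)
  have "xi_half holomorphic_on {s. 0 < Re s \<and> Re s < 1}"
    by (rule holomorphic_on_subset[OF xi_half_holomorphic]) auto
  then have "f holomorphic_on {s. 0 < Re s \<and> Re s < 1}"
    by (rule holomorphic_transform) (simp add: eq)
  then have "f analytic_on {s}"
    using open_strip assms unfolding analytic_at by blast
  then have "remove_sings f s = f s" by (rule remove_sings_at_analytic)
  then show ?thesis using eq[OF assms] by (simp add: riemann_xi_def f_def)
qed

section \<open>The Mellin transform of the Gaussian kernel\<close>

text \<open>Converts the factorials of the sinh series into the denominators of a Kummer series with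
  lower parameter \<open>3 / 2\<close>.\<close>

lemma pochhammer_three_halves_eq_fact:
  "pochhammer (3 / 2 :: 'a::field_char_0) n * fact n * 4 ^ n = fact (2 * n + 1)"
proof (induction n)
  case (Suc n)
  have "pochhammer (3 / 2 :: 'a) (Suc n) * fact (Suc n) * 4 ^ Suc n
      = (pochhammer (3 / 2) n * fact n * 4 ^ n) * ((3 / 2 + of_nat n) * of_nat (Suc n) * 4)"
    by (simp add: pochhammer_Suc algebra_simps)
  also have "\<dots> = fact (2 * n + 1) * (of_nat (2 * n + 2) * of_nat (2 * n + 3))"
  proof -
    have "(3 / 2 + of_nat n) * of_nat (Suc n) * 4 = (of_nat (2 * n + 2) * of_nat (2 * n + 3) :: 'a)"
      by (simp add: field_simps)
    then show ?thesis by (simp only: Suc.IH)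
  qed
  also have "\<dots> = fact (Suc (Suc (2 * n + 1)))"
    unfolding fact_Suc[of "Suc (2 * n + 1)"] fact_Suc[of "2 * n + 1"] by (simp add: add.commute mult_ac del: fact_Suc)
  also have "Suc (Suc (2 * n + 1)) = 2 * Suc n + 1" by simp
  finally show ?case .
qed simp

lemma pochhammer_three_halves_nonzero: "pochhammer (3 / 2 :: 'a::field_char_0) n \<noteq> 0"
  using pochhammer_three_halves_eq_fact[of n, where 'a = 'a] by (metis fact_nonzero mult_zero_left)

definition kummer_term :: "complex \<Rightarrow> complex \<Rightarrow> nat \<Rightarrow> complex" where
  "kummer_term a w n = pochhammer a n / (pochhammer (3 / 2) n * fact n) * w ^ n"

lemma summable_norm_kummer_term: "summable (\<lambda>n. norm (kummer_term a w n))"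
proof (rule summable_ratio_test)
  \<comment> \<open>From this index on the ratio bound \<open>(norm a + 1) * norm w / Suc n\<close>
    is at most \<open>1 / 2\<close>.\<close>
  define N where "N = nat \<lceil>2 * ((norm a + 1) * norm w)\<rceil>"
  fix n assume n: "n \<ge> N"
  have eq: "kummer_term a w (Suc n) = kummer_term a w n * ((a + of_nat n) * w / ((3 / 2 + of_nat n) * of_nat (Suc n)))"
    by (simp add: kummer_term_def pochhammer_Suc mult_ac)
  have "norm (a + of_nat n) \<le> (norm a + 1) * real (Suc n)"
  proof -
    have "norm (a + of_nat n) \<le> norm a + real n" using norm_triangle_ineq[of a "of_nat n"] by simp
    also have "\<dots> \<le> (norm a + 1) * real (Suc n)" by (simp add: algebra_simps)
    finally show ?thesis .
  qed
  moreover have "real (Suc n) \<le> norm (3 / 2 + of_nat n :: complex)"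
    using abs_Re_le_cmod[of "3 / 2 + of_nat n :: complex"] by simp
  ultimately have "norm (a + of_nat n) * norm w / (norm (3 / 2 + of_nat n :: complex) * real (Suc n))
      \<le> ((norm a + 1) * real (Suc n)) * norm w / (real (Suc n) * real (Suc n))"
    by (intro frac_le mult_mono) auto
  also have "\<dots> = (norm a + 1) * norm w / real (Suc n)" by (simp del: of_nat_Suc)
  also have "\<dots> \<le> 1 / 2"
  proof -
    have "2 * ((norm a + 1) * norm w) \<le> real N" unfolding N_def by (rule real_nat_ceiling_ge)
    also have "\<dots> \<le> real (Suc n)" using n by simp
    finally show ?thesis by (simp add: field_simps)
  qed
  finally have "norm ((a + of_nat n) * w / ((3 / 2 + of_nat n) * of_nat (Suc n))) \<le> 1 / 2"
    by (simp add: norm_mult norm_divide del: of_nat_Suc)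
  from mult_left_mono[OF this norm_ge_zero[of "kummer_term a w n"]]
  show "norm (norm (kummer_term a w (Suc n))) \<le> 1 / 2 * norm (norm (kummer_term a w n))"
    unfolding eq norm_mult[of "kummer_term a w n"] by (simp only: abs_norm_cancel real_norm_def abs_mult mult.commute[of "1 / 2"])
qed simp

lemma kummer_1F1_sums: "kummer_term a w sums kummer_1F1 a (3 / 2) w"
proof -
  have "kummer_1F1 a (3 / 2) w = (\<Sum>n. kummer_term a w n)"
    by (simp add: kummer_1F1_def eval_fps_def kummer_term_def)
  then show ?thesis
    using summable_norm_cancel[OF summable_norm_kummer_term] by (simp add: summable_sums)
qed

definition gauss_sinh :: "complex \<Rightarrow> real \<Rightarrow> complex" where
  "gauss_sinh z x = of_real (exp (- pi * x^2)) * sinh (of_real (sqrt pi * x) * z)"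

definition gauss_sinh_mellin :: "complex \<Rightarrow> complex \<Rightarrow> complex" where
  "gauss_sinh_mellin z s = z / 2 * of_real pi powr (- s / 2) * Gamma ((1 + s) / 2) * kummer_1F1 ((1 + s) / 2) (3 / 2) (z^2 / 4)"

text \<open>The Mellin transform of the Gaussian times the \<open>n\<close>-th term of the sinh
  series.\<close>

definition gauss_sinh_coeff :: "complex \<Rightarrow> complex \<Rightarrow> nat \<Rightarrow> complex" where
  "gauss_sinh_coeff z s n = (of_real (sqrt pi) * z) ^ (2 * n + 1) / fact (2 * n + 1)
     * (of_real pi powr (- (s + of_nat (2 * n + 1)) / 2) * Gamma ((s + of_nat (2 * n + 1)) / 2) / 2)"

lemma mellin_gauss:
  assumes "Re s > 0"
  shows "has_bochner_integral lborel (\<lambda>u. of_real (exp (- pi * (exp u)^2)) * exp (s * of_real u))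
    (of_real pi powr (- s / 2) * Gamma (s / 2) / 2)"
proof -
  have "has_bochner_integral lborel (\<lambda>u. of_real (exp (- pi * exp (2 * u))) * exp (s / 2 * of_real (2 * u)))
    (of_real pi powr (- (s / 2)) * Gamma (s / 2) / 2)"
    by (rule integral_double[OF mellin_exp]) (use assms in auto)
  then show ?thesis by (simp add: exp_double)
qed

text \<open>The integer shift in \<open>Gamma ((1 + s) / 2 + n)\<close> yields the numerator
  Pochhammer symbol, \<open>fact (2 * n + 1)\<close> the denominator, and the odd powers of
  \<open>sqrt pi\<close> cancel.\<close>

lemma gauss_sinh_coeff_eq:
  assumes "Re s > -1"
  shows "gauss_sinh_coeff z s n = z / 2 * of_real pi powr (- s / 2) * Gamma ((1 + s) / 2) * kummer_term ((1 + s) / 2) (z^2 / 4) n"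
proof -
  let ?a = "(1 + s) / 2"
  have a: "Re ?a > 0" using assms by simp
  have half: "(s + of_nat (2 * n + 1)) / 2 = ?a + of_nat n" by (simp add: field_simps)
  have G: "Gamma (?a + of_nat n) = Gamma ?a * pochhammer ?a n"
    using pochhammer_Gamma[OF Re_pos_not_nonpos_Int[OF a], of n] Gamma_nonzero_Re_pos[OF a] by simp
  have "of_real pi powr (- (s + of_nat (2 * n + 1)) / 2) = of_real pi powr (- s / 2) * of_real pi powr (- (of_nat (2 * n + 1) / 2))"
  proof -
    have "- (s + of_nat (2 * n + 1)) / 2 = - s / 2 + - (of_nat (2 * n + 1) / 2)" by (simp add: field_simps)
    then show ?thesis by (simp only: powr_add)
  qed
  also have "of_real pi powr (- (of_nat (2 * n + 1) / 2)) = inverse ((of_real (sqrt pi) :: complex) ^ (2 * n + 1))"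
  proof -
    have "of_real pi powr (- (of_nat (2 * n + 1) / 2)) = complex_of_real (pi powr (- (real (2 * n + 1) / 2)))"
      by (subst powr_of_real[symmetric]) auto
    also have "pi powr (- (real (2 * n + 1) / 2)) = inverse (pi powr (1 / 2 * real (2 * n + 1)))"
      by (simp add: powr_minus field_simps)
    also have "pi powr (1 / 2 * real (2 * n + 1)) = sqrt pi ^ (2 * n + 1)"
      by (simp only: powr_powr[symmetric] powr_half_sqrt pi_ge_zero) (subst powr_realpow, auto)
    finally show ?thesis by simp
  qed
  finally have P: "of_real pi powr (- (s + of_nat (2 * n + 1)) / 2)
     = of_real pi powr (- s / 2) * inverse ((of_real (sqrt pi) :: complex) ^ (2 * n + 1))" .
  have nz: "(of_real (sqrt pi) :: complex) ^ (2 * n + 1) \<noteq> 0" by simp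
  have "gauss_sinh_coeff z s n = z ^ (2 * n + 1) / fact (2 * n + 1) * (of_real pi powr (- s / 2) * (Gamma ?a * pochhammer ?a n) / 2)"
  proof -
    have "(r * y) / f * (q * inverse r * (c * d) / 2) = y / f * (q * (c * d) / 2)" if "r \<noteq> 0" for r y f q c d :: complex
      using that by simp
    from this[OF nz] show ?thesis unfolding gauss_sinh_coeff_def P half G power_mult_distrib .
  qed
  also have "z ^ (2 * n + 1) / fact (2 * n + 1) = z * ((z^2 / 4) ^ n / (pochhammer (3 / 2) n * fact n))"
    unfolding pochhammer_three_halves_eq_fact[symmetric] power_add power_mult power_divide by (simp add: mult_ac)
  finally show ?thesis
    by (simp add: kummer_term_def mult_ac)
qed

lemma gauss_sinh_coeff_sums:
  assumes "Re s > -1"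
  shows "gauss_sinh_coeff z s sums gauss_sinh_mellin z s"
  unfolding gauss_sinh_coeff_eq[OF assms, abs_def] gauss_sinh_mellin_def
  by (intro sums_mult kummer_1F1_sums)

lemma sinh_odd_sums: "(\<lambda>n. w ^ (2 * n + 1) / fact (2 * n + 1)) sums sinh (w::complex)"
proof -
  have "(\<lambda>n. (\<lambda>n. if even n then 0 else w ^ n /\<^sub>R fact n) (2 * n + 1)) sums sinh w \<longleftrightarrow>
      (\<lambda>n. if even n then 0 else w ^ n /\<^sub>R fact n) sums sinh w"
    by (rule sums_mono_reindex) (auto simp: strict_mono_def elim!: oddE)
  then show ?thesis
    using sinh_converges[of w] by (simp add: scaleR_conv_of_real divide_inverse mult.commute del: fact_Suc power_Suc)
qed

text \<open>Termwise integration of the sinh series. The zero of sinh at 0 extends the half-plane to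
  \<open>Re s > -1\<close>; this matters because \<open>s = 0\<close> is where \<open>erfi\<close>
  appears.\<close>

lemma mellin_gauss_sinh:
  assumes "Re s > -1"
  shows "has_bochner_integral lborel (\<lambda>u. gauss_sinh z (exp u) * exp (s * of_real u)) (gauss_sinh_mellin z s)"
proof -
  define g where "g = (\<lambda>z s n u. (of_real (sqrt pi) * z) ^ (2 * n + 1) / fact (2 * n + 1)
     * (complex_of_real (exp (- pi * (exp u)^2)) * exp ((s + of_nat (2 * n + 1)) * of_real u)))"
  have g_int: "has_bochner_integral lborel (g z s n) (gauss_sinh_coeff z s n)" if "Re s > -1" for z s n
    unfolding g_def gauss_sinh_coeff_def
    by (intro has_bochner_integral_mult_right mellin_gauss) (use that in auto)
  have g_eq: "g z s n u = of_real (exp (- pi * (exp u)^2)) * exp (s * of_real u) *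
      ((of_real (sqrt pi * exp u) * z) ^ (2 * n + 1) / fact (2 * n + 1))" for z s n u
  proof -
    have "exp ((s + of_nat (2 * n + 1)) * of_real u) = exp (s * of_real u) * of_real (exp u) ^ (2 * n + 1)"
      by (simp only: distrib_right exp_add exp_of_nat_mult exp_of_real[symmetric])
    then show ?thesis by (simp add: g_def power_mult_distrib mult_ac del: fact_Suc power_Suc)
  qed
  have g_sums: "(\<lambda>n. g z s n u) sums (gauss_sinh z (exp u) * exp (s * of_real u))" for u
  proof -
    have "(\<lambda>n. g z s n u) sums (of_real (exp (- pi * (exp u)^2)) * exp (s * of_real u) * sinh (of_real (sqrt pi * exp u) * z))"
      unfolding g_eq by (intro sums_mult sinh_odd_sums)
    then show ?thesis by (simp add: gauss_sinh_def mult_ac)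
  qed
  let ?z = "complex_of_real (norm z)" and ?s = "complex_of_real (Re s)"
  \<comment> \<open>Norms turn the parameters \<open>z\<close>, \<open>s\<close> into
    \<open>norm z\<close>, \<open>Re s\<close>, so the absolute integrals are coefficients of the
    same kind, already known to be summable.\<close>
  have norm_g: "norm (g z s n u) = Re (g ?z ?s n u)" for n u
  proof -
    define X where "X = exp (- pi * (exp u)^2) * exp (Re s * u) * ((sqrt pi * exp u * norm z) ^ (2 * n + 1) / fact (2 * n + 1))"
    have "exp (?s * of_real u) = of_real (exp (Re s * u))"
      by (simp add: exp_of_real flip: of_real_mult)
    then have "g ?z ?s n u = of_real X" unfolding g_eq X_def by simp
    moreover have "norm (g z s n u) = X"
      unfolding g_eq X_def by (simp add: norm_mult norm_divide norm_power del: fact_Suc power_Suc)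
    ultimately show ?thesis by simp
  qed
  have s': "Re ?s > -1" using assms by simp
  have int_norm: "(\<integral>u. norm (g z s n u) \<partial>lborel) = Re (gauss_sinh_coeff ?z ?s n)" for n
    unfolding norm_g using g_int[OF s'] by (subst integral_Re) (auto simp: has_bochner_integral_iff)
  have AE: "AE u in lborel. summable (\<lambda>n. norm (g z s n u))"
  proof (rule AE_I2)
    fix u
    have "summable (\<lambda>n. g ?z ?s n u)"
      unfolding g_eq by (intro summable_mult sums_summable[OF sinh_odd_sums])
    then show "summable (\<lambda>n. norm (g z s n u))"
      unfolding norm_g by (rule summable_Re)
  qed
  have "summable (\<lambda>n. gauss_sinh_coeff ?z ?s n)"
    using gauss_sinh_coeff_sums[OF s'] sums_summable by blast
  then have sum: "summable (\<lambda>n. \<integral>u. norm (g z s n u) \<partial>lborel)"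
    unfolding int_norm by (rule summable_Re)
  have int: "integrable lborel (g z s n)" for n
    using g_int[OF assms] by (simp add: has_bochner_integral_iff)
  have "integrable lborel (\<lambda>u. \<Sum>n. g z s n u)"
    using int AE sum by (rule integrable_suminf)
  moreover have "(\<lambda>n. integral\<^sup>L lborel (g z s n)) sums (\<integral>u. (\<Sum>n. g z s n u) \<partial>lborel)"
    using int AE sum by (rule sums_integral)
  then have "(\<integral>u. (\<Sum>n. g z s n u) \<partial>lborel) = gauss_sinh_mellin z s"
    unfolding has_bochner_integral_integral_eq[OF g_int[OF assms]]
    using gauss_sinh_coeff_sums[OF assms] sums_unique2 by blast
  ultimately show ?thesis
    using sums_unique[OF g_sums] by (simp add: has_bochner_integral_iff)
qed

section \<open>Decay of the Gaussian transform along the critical line\<close>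

lemma norm_Gamma_le:
  assumes "Re s > 0"
  shows "norm (Gamma s) \<le> Re (Gamma (of_real (Re s)))"
proof -
  have s': "Re (of_real (Re s)) > 0" using assms by simp
  have "norm (Gamma s) \<le> (\<integral>u. norm (exp (s * of_real u) * of_real (exp (- exp u))) \<partial>lborel)"
    using integral_norm_bound[of lborel "\<lambda>u. exp (s * of_real u) * complex_of_real (exp (- exp u))"]
      has_bochner_integral_integral_eq[OF Gamma_integral_exp[OF assms]] by (simp only:)
  also have "(\<lambda>u. norm (exp (s * of_real u) * complex_of_real (exp (- exp u)))) = (\<lambda>u. Re (exp (of_real (Re s) * of_real u) * of_real (exp (- exp u))))"
    by (simp add: norm_mult fun_eq_iff exp_of_real flip: of_real_mult)
  also have "(\<integral>u. Re (exp (of_real (Re s) * of_real u) * of_real (exp (- exp u))) \<partial>lborel) = Re (Gamma (of_real (Re s)))"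
    using Gamma_integral_exp[OF s'] by (subst integral_Re) (auto simp: has_bochner_integral_iff)
  finally show ?thesis .
qed

text \<open>
  Shifting the argument by 2, \<open>\<Gamma>(b) = \<Gamma>(b + 2) / (b (b + 1))\<close>, gains the factor \<open>1 / (1 + t\<^sup>2)\<close>
  in each term of the series at the cost of moving the real part from \<open>3/4\<close> to \<open>11/4\<close>.
\<close>

lemma Gamma_kummer_decay:
  obtains C where "\<And>t. norm (Gamma (3 / 4 + \<i> * of_real t / 2) * kummer_1F1 (3 / 4 + \<i> * of_real t / 2) (3 / 2) w) \<le> C / (1 + t^2)"
proof -
  let ?w = "complex_of_real (norm w)" and ?c = "11 / 4 :: complex"
  define C where "C = 4 * Re (Gamma ?c * kummer_1F1 ?c (3 / 2) ?w)"
  have shift: "Gamma a * kummer_term a w n = Gamma (a + of_nat n) * (w ^ n / (pochhammer (3 / 2) n * fact n))"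
    if "Re a > 0" for a w n
    using pochhammer_Gamma[OF Re_pos_not_nonpos_Int[OF that], of n] Gamma_nonzero_Re_pos[OF that]
    by (simp add: kummer_term_def)
  have "norm (Gamma (3 / 4 + \<i> * of_real t / 2) * kummer_1F1 (3 / 4 + \<i> * of_real t / 2) (3 / 2) w) \<le> C / (1 + t^2)" for t
  proof -
    define a where "a = 3 / 4 + \<i> * of_real t / 2"
    have a: "Re a > 0" by (simp add: a_def)
    have bound: "norm (Gamma a * kummer_term a w n) \<le> 4 / (1 + t^2) * Re (Gamma ?c * kummer_term ?c ?w n)" for n
    proof -
      define b where "b = a + of_nat n"
      have b: "Re b = 3 / 4 + real n" "Im b = t / 2" by (simp_all add: b_def a_def)
      have b0: "b \<notin> \<int>\<^sub>\<le>\<^sub>0" "b + 1 \<notin> \<int>\<^sub>\<le>\<^sub>0" using b by (auto intro!: Re_pos_not_nonpos_Int)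
      then have bnz: "b \<noteq> 0" "b + 1 \<noteq> 0" by auto
      have "Gamma (b + 2) = (b + 1) * (b * Gamma b)"
        using Gamma_plus1[OF b0(1)] Gamma_plus1[OF b0(2)] by (simp add: add.assoc)
      then have G: "Gamma b = Gamma (b + 2) / (b * (b + 1))" using bnz by simp
      \<comment> \<open>The real part of \<open>b\<close> is at least \<open>3 / 4\<close>, hence
        more than \<open>1 / 2\<close>; this is the origin of the constant 4.\<close>
      have n1: "(1 + t^2) / 4 \<le> (norm b)^2"
      proof -
        have "(3 / 4)^2 \<le> (Re b)^2" unfolding b by (intro power_mono) auto
        then have "(3 / 4)^2 + (t / 2)^2 \<le> (norm b)^2" unfolding cmod_power2 by (simp add: b)
        then show ?thesis by (simp add: power_divide)
      qed
      have "norm b \<le> norm (b + 1)"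
      proof (rule power2_le_imp_le)
        have "(Re b)^2 \<le> (Re b + 1)^2" using b by (intro power_mono) auto
        then show "(norm b)^2 \<le> (norm (b + 1))^2" unfolding cmod_power2 by simp
      qed simp
      then have "(norm b)^2 \<le> norm b * norm (b + 1)" by (simp add: power2_eq_square mult_left_mono)
      with n1 have n2: "(1 + t^2) / 4 \<le> norm (b * (b + 1))" by (simp add: norm_mult)
      have pos: "(1 + t^2) / 4 > 0" by (simp add: add_pos_nonneg)
      have Gle: "norm (Gamma (b + 2)) \<le> Re (Gamma (?c + of_nat n))"
        using norm_Gamma_le[of "b + 2"] b by simp
      have "norm (Gamma b) = norm (Gamma (b + 2)) / norm (b * (b + 1))"
        by (subst G) (simp only: norm_divide)
      also have "\<dots> \<le> Re (Gamma (?c + of_nat n)) / ((1 + t^2) / 4)"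
        using Gle n2 pos order_trans[OF norm_ge_zero Gle] by (intro frac_le) auto
      finally have Gb: "norm (Gamma b) \<le> 4 / (1 + t^2) * Re (Gamma (?c + of_nat n))"
        by (simp add: mult.commute)
      define r where "r = norm w ^ n / (pochhammer (3 / 2) n * fact n)"
      have r: "r \<ge> 0" by (simp add: r_def pochhammer_nonneg)
      have pr: "pochhammer (3 / 2) n = complex_of_real (pochhammer (3 / 2) n)"
        by (simp flip: pochhammer_of_real)
      have "norm (Gamma a * kummer_term a w n) = norm (Gamma b) * r"
        unfolding shift[OF a] b_def[symmetric] pr r_def
        by (simp add: norm_mult norm_divide norm_power pochhammer_nonneg)
      also have "\<dots> \<le> 4 / (1 + t^2) * Re (Gamma (?c + of_nat n)) * r"
        using Gb r by (rule mult_right_mono)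
      also have "\<dots> = 4 / (1 + t^2) * Re (Gamma (?c + of_nat n) * of_real r)" by simp
      also have "complex_of_real r = ?w ^ n / (pochhammer (3 / 2) n * fact n)"
        unfolding pr r_def by simp
      also have "Gamma (?c + of_nat n) * (?w ^ n / (pochhammer (3 / 2) n * fact n)) = Gamma ?c * kummer_term ?c ?w n"
        by (rule shift[symmetric]) simp
      finally show ?thesis .
    qed
    have sum: "summable (\<lambda>n. norm (Gamma a * kummer_term a w n))"
      unfolding norm_mult by (intro summable_mult summable_norm_kummer_term)
    have sumR: "(\<lambda>n. 4 / (1 + t^2) * Re (Gamma ?c * kummer_term ?c ?w n)) sums (4 / (1 + t^2) * Re (Gamma ?c * kummer_1F1 ?c (3 / 2) ?w))"
      by (intro sums_mult sums_Re kummer_1F1_sums)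
    have "norm (Gamma a * kummer_1F1 a (3 / 2) w) = norm (\<Sum>n. Gamma a * kummer_term a w n)"
      using sums_mult[OF kummer_1F1_sums] by (simp add: sums_iff)
    also have "\<dots> \<le> (\<Sum>n. norm (Gamma a * kummer_term a w n))"
      by (rule summable_norm[OF sum])
    also have "\<dots> \<le> (\<Sum>n. 4 / (1 + t^2) * Re (Gamma ?c * kummer_term ?c ?w n))"
      using bound sum sums_summable[OF sumR] by (rule suminf_le)
    also have "\<dots> = C / (1 + t^2)"
      using sums_unique[OF sumR] by (simp add: C_def)
    finally show ?thesis by (simp add: a_def)
  qed
  then show ?thesis by (rule that)
qed

section \<open>Kummer's transformation and the error functions\<close>

text \<open>Brings the factorials of a Cauchy product with the exponential series into the form of
  the Chu-Vandermonde sum.\<close>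

lemma pochhammer_minus_of_nat:
  "k \<le> n \<Longrightarrow> pochhammer (- of_nat n :: 'a::field_char_0) k * fact (n - k) = (- 1) ^ k * fact n"
proof (induction k)
  case (Suc k)
  have "fact (n - k) = (of_nat n - of_nat k :: 'a) * fact (n - Suc k)"
    using Suc.prems by (simp add: fact_reduce[of "n - k"] of_nat_diff)
  moreover have "q * (- x + y) * f = - (q * ((x - y) * f))" for q x y f :: 'a
    by (simp add: algebra_simps)
  ultimately have "pochhammer (- of_nat n :: 'a) (Suc k) * fact (n - Suc k) = - (pochhammer (- of_nat n) k * fact (n - k))"
    by (simp only: pochhammer_Suc)
  then show ?case using Suc by simp
qed simp

text \<open>Each coefficient of the Cauchy product on the right is a terminating Gauss series at 1
  with upper parameters \<open>a\<close> and \<open>- n\<close>, which the Chu-Vandermonde identity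
  evaluates.\<close>

lemma kummer_transformation:
  "kummer_1F1 (3 / 2 - a) (3 / 2) (- w) = exp (- w) * kummer_1F1 a (3 / 2) w"
proof -
  have "(\<lambda>n. \<Sum>k\<le>n. kummer_term a w k * ((- w) ^ (n - k) /\<^sub>R fact (n - k)))
      sums ((\<Sum>k. kummer_term a w k) * (\<Sum>k. (- w) ^ k /\<^sub>R fact k))"
    by (intro Cauchy_product_sums summable_norm_kummer_term summable_norm_exp)
  also have "(\<Sum>k. kummer_term a w k) * (\<Sum>k. (- w) ^ k /\<^sub>R fact k) = kummer_1F1 a (3 / 2) w * exp (- w)"
    using kummer_1F1_sums[of a w] exp_converges[of "- w"] by (simp add: sums_iff)
  also have "(\<lambda>n. \<Sum>k\<le>n. kummer_term a w k * ((- w) ^ (n - k) /\<^sub>R fact (n - k))) = kummer_term (3 / 2 - a) (- w)"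
  proof
    fix n
    have c: "\<forall>i\<in>{0..<n}. (3 / 2 :: complex) \<noteq> - of_nat i"
      by (auto simp: complex_eq_iff)
    have "kummer_term a w k * ((- w) ^ (n - k) /\<^sub>R fact (n - k))
       = (- w) ^ n / fact n * (pochhammer a k * pochhammer (- of_nat n) k / (fact k * pochhammer (3 / 2) k))"
      if "k \<le> n" for k
    proof -
      have "fact (n - k) \<noteq> (0::complex)" by simp
      then have P: "pochhammer (- of_nat n :: complex) k = (- 1) ^ k * fact n / fact (n - k)"
        using pochhammer_minus_of_nat[OF that, where 'a = complex] by (simp add: field_simps)
      have W: "(- w) ^ n * (- 1) ^ k = w ^ k * (- w) ^ (n - k)"
      proof -
        have "(- w) ^ n = (- w) ^ k * (- w) ^ (n - k)" using that by (simp flip: power_add)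
        moreover have "(- w) ^ k * (- 1) ^ k = w ^ k" by (simp flip: power_mult_distrib)
        ultimately show ?thesis by (metis mult.assoc mult.commute)
      qed
      have "(- w) ^ n / fact n * (pochhammer a k * pochhammer (- of_nat n) k / (fact k * pochhammer (3 / 2) k))
        = ((- w) ^ n * (- 1) ^ k) * (pochhammer a k / (fact k * pochhammer (3 / 2) k * fact (n - k)))"
        unfolding P by (simp add: mult_ac)
      also have "\<dots> = kummer_term a w k * ((- w) ^ (n - k) /\<^sub>R fact (n - k))"
      proof -
        have "y /\<^sub>R fact m = y / fact m" for y :: complex and m
          by (simp add: scaleR_conv_of_real field_simps)
        then show ?thesis unfolding W kummer_term_def by (simp add: mult_ac)
      qed
      finally show ?thesis ..
    qed
    then have "(\<Sum>k\<le>n. kummer_term a w k * ((- w) ^ (n - k) /\<^sub>R fact (n - k)))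
       = (- w) ^ n / fact n * (\<Sum>k\<in>{0..n}. pochhammer a k * pochhammer (- of_nat n) k / (fact k * pochhammer (3 / 2) k))"
      unfolding sum_distrib_left by (intro sum.cong) auto
    also have "(\<Sum>k\<in>{0..n}. pochhammer a k * pochhammer (- of_nat n) k / (fact k * pochhammer (3 / 2) k))
       = pochhammer (3 / 2 - a) n / pochhammer (3 / 2) n"
      using Vandermonde_pochhammer[OF c, of a] by (simp only: of_nat_fact)
    also have "(- w) ^ n / fact n * (pochhammer (3 / 2 - a) n / pochhammer (3 / 2) n) = kummer_term (3 / 2 - a) (- w) n"
      by (simp add: kummer_term_def mult_ac)
    finally show "(\<Sum>k\<le>n. kummer_term a w k * ((- w) ^ (n - k) /\<^sub>R fact (n - k))) = kummer_term (3 / 2 - a) (- w) n" .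
  qed
  finally show ?thesis
    using kummer_1F1_sums[of "3 / 2 - a" "- w"] sums_unique2 by (metis mult.commute)
qed

text \<open>Since \<open>pochhammer (3 / 2) n\<close> is \<open>2 * n + 1\<close> times
  \<open>pochhammer (1 / 2) n\<close>, the series \<open>F\<close> satisfies
  \<open>F + 2 x F' = exp x\<close>. At \<open>x = w^2\<close> the left side is the derivative of
  \<open>w * F (w^2)\<close>.\<close>

lemma kummer_half_derivative:
  "((\<lambda>w. w * kummer_1F1 (1 / 2) (3 / 2) (w^2)) has_field_derivative exp (w^2)) (at w)"
proof -
  define F :: "complex fps" where "F = fps_hypergeo [1 / 2] [3 / 2] 1"
  have F_nth: "F $ n = pochhammer (1 / 2) n / (pochhammer (3 / 2) n * fact n)" for n
    by (simp add: F_def)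
  have K: "kummer_1F1 (1 / 2) (3 / 2) x = eval_fps F x" for x
    by (simp add: kummer_1F1_def F_def)
  have "summable (\<lambda>n. F $ n * x ^ n)" for x
    using summable_norm_cancel[OF summable_norm_kummer_term[of "1 / 2" x]]
    by (simp add: kummer_term_def F_nth)
  then have "conv_radius (fps_nth F) = \<infinity>"
    by (intro conv_radius_inftyI'')
  then have rad: "fps_conv_radius F = \<infinity>" by (simp add: fps_conv_radius_def)
  then have rad': "fps_conv_radius (fps_deriv F) = \<infinity>"
    using fps_conv_radius_deriv[of F] by simp
  have ode: "F + fps_const 2 * (fps_X * fps_deriv F) = fps_exp 1"
  proof (rule fps_ext)
    fix n
    have p: "pochhammer (3 / 2 :: complex) n = pochhammer (1 / 2) n * (2 * of_nat n + 1)"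
    proof -
      have "1 / 2 * pochhammer (3 / 2 :: complex) n = pochhammer (1 / 2) n * (1 / 2 + of_nat n)"
        using pochhammer_rec[of "1 / 2 :: complex" n] pochhammer_Suc[of "1 / 2 :: complex" n] by simp
      then have "2 * (1 / 2 * pochhammer (3 / 2 :: complex) n) = 2 * (pochhammer (1 / 2) n * (1 / 2 + of_nat n))"
        by (simp only:)
      then show ?thesis by (simp add: algebra_simps)
    qed
    have "(fps_X * fps_deriv F) $ n = of_nat n * F $ n"
      by (cases n) simp_all
    then have "(F + fps_const 2 * (fps_X * fps_deriv F)) $ n = F $ n * (2 * of_nat n + 1)"
      by (simp add: algebra_simps)
    also have "\<dots> = (pochhammer (1 / 2) n * (2 * of_nat n + 1)) / (pochhammer (3 / 2) n * fact n)"
      unfolding F_nth by simp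
    also have "\<dots> = fps_exp 1 $ n"
      unfolding p[symmetric] using pochhammer_three_halves_nonzero[of n, where 'a = complex] by simp
    finally show "(F + fps_const 2 * (fps_X * fps_deriv F)) $ n = fps_exp 1 $ n" .
  qed
  have radX: "fps_conv_radius (fps_X * fps_deriv F) = \<infinity>"
    using fps_conv_radius_mult[of fps_X "fps_deriv F"] rad' by simp
  have radcX: "fps_conv_radius (fps_const 2 * (fps_X * fps_deriv F)) = \<infinity>"
    using fps_conv_radius_mult[of "fps_const 2" "fps_X * fps_deriv F"] radX by simp
  have eval_ode: "eval_fps F x + 2 * (x * eval_fps (fps_deriv F) x) = exp x" for x
  proof -
    have "eval_fps (F + fps_const 2 * (fps_X * fps_deriv F)) x = eval_fps F x + 2 * (x * eval_fps (fps_deriv F) x)"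
      using rad rad' radX radcX by (simp add: eval_fps_add eval_fps_mult)
    then show ?thesis unfolding ode by simp
  qed
  have dF: "((\<lambda>w. eval_fps F (w^2)) has_field_derivative eval_fps (fps_deriv F) (w^2) * (2 * w)) (at w)"
    by (rule DERIV_chain2[OF has_field_derivative_eval_fps]) (auto intro!: derivative_eq_intros simp: rad)
  have "((\<lambda>w. w * eval_fps F (w^2)) has_field_derivative
      1 * eval_fps F (w^2) + eval_fps (fps_deriv F) (w^2) * (2 * w) * w) (at w)"
    by (intro DERIV_mult dF DERIV_ident)
  also have "1 * eval_fps F (w^2) + eval_fps (fps_deriv F) (w^2) * (2 * w) * w = exp (w^2)"
    using eval_ode[of "w^2"] by (simp add: power2_eq_square mult_ac)
  finally show ?thesis unfolding K .
qed

lemma erfi_kummer: "erfi w = 2 / of_real (sqrt pi) * (w * kummer_1F1 (1 / 2) (3 / 2) (w^2))"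
proof -
  have "((\<lambda>t. exp (t^2)) has_contour_integral
      (pathfinish (linepath 0 w) * kummer_1F1 (1 / 2) (3 / 2) (pathfinish (linepath 0 w)^2)
       - pathstart (linepath 0 w) * kummer_1F1 (1 / 2) (3 / 2) (pathstart (linepath 0 w)^2))) (linepath 0 w)"
    by (rule contour_integral_primitive[where S = UNIV, OF kummer_half_derivative]) auto
  then show ?thesis by (simp add: erfi_def contour_integral_unique)
qed

lemma erf_kummer: "erf w = 2 / of_real (sqrt pi) * (w * kummer_1F1 (1 / 2) (3 / 2) (- (w^2)))"
proof -
  define P where "P = (\<lambda>w. w * kummer_1F1 (1 / 2) (3 / 2) (w^2))"
  have d: "((\<lambda>t. - \<i> * P (\<i> * t)) has_field_derivative exp (- (t^2))) (at t)" for t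
  proof -
    have "((\<lambda>t. P (\<i> * t)) has_field_derivative exp ((\<i> * t)^2) * (\<i> * 1)) (at t)"
      unfolding P_def by (rule DERIV_chain2[OF kummer_half_derivative DERIV_cmult[OF DERIV_ident]])
    then have "((\<lambda>t. - \<i> * P (\<i> * t)) has_field_derivative - \<i> * (exp ((\<i> * t)^2) * (\<i> * 1))) (at t)"
      by (rule DERIV_cmult)
    moreover have "- \<i> * (x * (\<i> * 1)) = x" for x :: complex
      by (simp add: mult.left_commute[of \<i> x \<i>])
    ultimately show ?thesis by (simp add: power_mult_distrib)
  qed
  have "((\<lambda>t. exp (- (t^2))) has_contour_integral
      (- \<i> * P (\<i> * pathfinish (linepath 0 w)) - - \<i> * P (\<i> * pathstart (linepath 0 w)))) (linepath 0 w)"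
    by (rule contour_integral_primitive[where S = UNIV, OF d]) auto
  then have "contour_integral (linepath 0 w) (\<lambda>t. exp (- (t^2))) = - \<i> * P (\<i> * w)"
    by (simp add: contour_integral_unique P_def)
  then show ?thesis by (simp add: erf_def P_def power_mult_distrib mult.assoc)
qed

lemma erfi_ii: "erfi (\<i> * w) = \<i> * erf w"
  by (simp add: erfi_kummer erf_kummer power_mult_distrib)

text \<open>At \<open>s = 0\<close> the transform integrates against \<open>dx / x\<close>, which is
  how the term \<open>1 / (2 pi x)\<close> split off from \<open>bose\<close> turns into
  \<open>erfi\<close>.\<close>

lemma gauss_sinh_mellin_0: "gauss_sinh_mellin z 0 = of_real pi / 2 * erfi (z / 2)"
proof -
  have "gauss_sinh_mellin z 0 = z / 2 * of_real (sqrt pi) * kummer_1F1 (1 / 2) (3 / 2) (z^2 / 4)"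
    by (simp add: gauss_sinh_mellin_def Gamma_one_half_complex)
  moreover have "of_real pi / 2 * (2 / of_real (sqrt pi)) = complex_of_real (sqrt pi)"
    by (simp add: field_simps flip: of_real_mult)
  ultimately show ?thesis
    unfolding erfi_kummer power_divide mult.assoc[symmetric] by (simp only: mult.commute power2_eq_square mult_ac) simp
qed

section \<open>Parseval's formula\<close>

lemma norm_gauss_sinh_le:
  obtains B where "\<And>u. norm (gauss_sinh z (exp u) * exp (1 / 2 * of_real u)) \<le> B"
proof -
  \<comment> \<open>The summand 1 absorbs the factor \<open>exp (u / 2)\<close>, which is at most
    \<open>exp x\<close>; completing the square then gives the bound.\<close>
  define c where "c = sqrt pi * norm z + 1"
  have "norm (gauss_sinh z (exp u) * exp (1 / 2 * of_real u)) \<le> exp (c^2 / (4 * pi))" for u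
  proof -
    define x where "x = exp u"
    have x: "x > 0" by (simp add: x_def)
    have "norm (sinh w) \<le> exp (norm w)" for w :: complex
    proof -
      have "norm (sinh w) = norm (exp w - exp (- w)) / 2" by (simp add: sinh_def)
      also have "\<dots> \<le> (norm (exp w) + norm (exp (- w))) / 2" by (intro divide_right_mono norm_triangle_ineq4) auto
      also have "\<dots> \<le> (exp (norm w) + exp (norm (- w))) / 2" by (intro divide_right_mono add_mono norm_exp) auto
      finally show ?thesis by simp
    qed
    from this[of "of_real (sqrt pi * x) * z"] x
    have "norm (sinh (of_real (sqrt pi * x) * z)) \<le> exp (sqrt pi * x * norm z)"
      by (simp add: norm_mult)
    then have g: "norm (gauss_sinh z x) \<le> exp (- pi * x^2) * exp (sqrt pi * x * norm z)"
      unfolding gauss_sinh_def norm_mult by (intro mult_mono) auto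
    have "u \<le> x" using exp_ge_add_one_self[of u] unfolding x_def by linarith
    then have "u / 2 \<le> x" using x by linarith
    then have h: "norm (exp (1 / 2 * complex_of_real u)) \<le> exp x" by simp
    have "norm (gauss_sinh z x * exp (1 / 2 * of_real u)) \<le> (exp (- pi * x^2) * exp (sqrt pi * x * norm z)) * exp x"
      unfolding norm_mult using g h by (intro mult_mono) auto
    also have "\<dots> = exp (- pi * x^2 + c * x)"
      by (simp add: c_def algebra_simps flip: exp_add)
    also have "- pi * x^2 + c * x \<le> c^2 / (4 * pi)"
    proof -
      have "0 \<le> (2 * pi * x - c)^2 / (4 * pi)" by simp
      also have "\<dots> = c^2 / (4 * pi) - (- pi * x^2 + c * x)"
        by (simp add: power2_eq_square field_simps)
      finally show ?thesis by simp
    qed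
    finally show ?thesis by (simp add: x_def)
  qed
  then show ?thesis by (rule that)
qed

lemma gauss_sinh_continuous: "continuous_on UNIV (\<lambda>u. gauss_sinh z (exp u) * exp (c * of_real u))"
proof -
  have "continuous_on UNIV (\<lambda>u. of_real (exp (- pi * (exp u)^2)) *
      ((exp (of_real (sqrt pi * exp u) * z) - exp (- (of_real (sqrt pi * exp u) * z))) /\<^sub>R 2) * exp (c * of_real u))"
    by (intro continuous_intros)
  then show ?thesis by (simp only: gauss_sinh_def sinh_def)
qed

section \<open>Absolute convergence on the critical line\<close>

lemma integrable_inverse_1_plus_sq: "integrable lborel (\<lambda>t::real. C / (1 + t^2))"
proof -
  have "integrable lborel (\<lambda>t::real. inverse (1 + t^2))"
    using integrable_inverse_1_plus_square by (simp add: set_integrable_def)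
  then have "integrable lborel (\<lambda>t::real. C * inverse (1 + t^2))" by simp
  then show ?thesis by (simp add: divide_inverse)
qed

text \<open>The decaying part of \<open>gauss_sinh_mellin\<close>; the parameter is
  \<open>(1 + s) / 2\<close> at \<open>s = 1 / 2 + \<i> * t\<close>.\<close>

definition kummer_line :: "complex \<Rightarrow> real \<Rightarrow> complex" where
  "kummer_line w t = Gamma (3 / 4 + \<i> * of_real t / 2) * kummer_1F1 (3 / 4 + \<i> * of_real t / 2) (3 / 2) w"

lemma kummer_line_integrable: "integrable lborel (kummer_line w)"
proof -
  have G: "(\<lambda>t. Gamma (3 / 4 + \<i> * complex_of_real t / 2)) \<in> borel_measurable borel"
  proof (intro borel_measurable_continuous_onI continuous_on_compose2[OF continuous_on_Gamma[of "- \<int>\<^sub>\<le>\<^sub>0"]] continuous_intros)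
    have "3 / 4 + \<i> * complex_of_real t / 2 \<notin> \<int>\<^sub>\<le>\<^sub>0" for t
      by (intro Re_pos_not_nonpos_Int) simp
    then show "(\<lambda>t. 3 / 4 + \<i> * complex_of_real t / 2) ` UNIV \<subseteq> - \<int>\<^sub>\<le>\<^sub>0" by auto
  qed auto
  have K: "(\<lambda>t. kummer_1F1 (3 / 4 + \<i> * complex_of_real t / 2) (3 / 2) w) \<in> borel_measurable borel"
  proof (rule borel_measurable_LIMSEQ_metric)
    show "(\<lambda>t. \<Sum>n<N. kummer_term (3 / 4 + \<i> * complex_of_real t / 2) w n) \<in> borel_measurable borel" for N
      unfolding kummer_term_def
      by (intro borel_measurable_continuous_onI continuous_intros continuous_on_compose2[OF continuous_on_pochhammer[of UNIV]])
         (auto simp: pochhammer_three_halves_nonzero)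
    show "(\<lambda>N. \<Sum>n<N. kummer_term (3 / 4 + \<i> * complex_of_real t / 2) w n)
        \<longlonglongrightarrow> kummer_1F1 (3 / 4 + \<i> * complex_of_real t / 2) (3 / 2) w" for t
      using kummer_1F1_sums by (simp add: sums_def)
  qed
  have meas: "kummer_line w \<in> borel_measurable borel"
    unfolding kummer_line_def by (rule borel_measurable_times[OF G K])
  obtain C where C: "\<And>t. norm (kummer_line w t) \<le> C / (1 + t^2)"
    using Gamma_kummer_decay[of w] unfolding kummer_line_def by blast
  have "norm (kummer_line w t) \<le> norm (C / (1 + t^2))" for t
    using C[of t] abs_ge_self[of "C / (1 + t^2)"] unfolding real_norm_def by (rule order_trans)
  then show ?thesis
    using meas by (intro Bochner_Integration.integrable_bound[OF integrable_inverse_1_plus_sq[of C]] AE_I2) simp_all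
qed

definition crit :: "real \<Rightarrow> complex" where "crit t = 1 / 2 + \<i> * of_real t"

lemma Re_crit [simp]: "Re (crit t) = 1 / 2" and one_minus_crit: "1 - crit t = crit (- t)"
  by (simp_all add: crit_def)

lemma gauss_sinh_mellin_crit:
  "gauss_sinh_mellin z (crit t) = z / 2 * (of_real pi powr (- crit t / 2) * kummer_line (z^2 / 4) t)"
proof -
  have "(1 + crit t) / 2 = 3 / 4 + \<i> * of_real t / 2" by (simp add: crit_def field_simps)
  then show ?thesis unfolding gauss_sinh_mellin_def kummer_line_def by (simp only: mult_ac)
qed

lemma measurable_crit_exp [measurable]:
  "(\<lambda>t. of_real pi powr (- crit t / 2)) \<in> borel_measurable borel"
  unfolding crit_def powr_def by measurable

lemma pi_powr_crit_bounded: "norm (of_real pi powr (- crit t / 2)) \<le> 1"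
proof -
  have "norm (of_real pi powr (- crit t / 2)) = pi powr (- (1 / 4))"
    by (simp add: norm_powr_real_powr)
  also have "\<dots> \<le> pi powr 0" using pi_gt3 by (intro powr_mono) auto
  finally show ?thesis by simp
qed

lemma gauss_sinh_mellin_crit_integrable: "integrable lborel (\<lambda>t. gauss_sinh_mellin z (crit t))"
proof -
  have meas [measurable]: "kummer_line (z^2 / 4) \<in> borel_measurable borel"
    using kummer_line_integrable by simp
  have "integrable lborel (\<lambda>t. of_real pi powr (- crit t / 2) * kummer_line (z^2 / 4) t)"
    by (rule Bochner_Integration.integrable_bound[OF kummer_line_integrable[of "z^2 / 4"]])
       (use borel_measurable_times[OF measurable_crit_exp meas] pi_powr_crit_bounded in
          \<open>auto simp: norm_mult intro!: mult_left_le_one_le\<close>)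
  then show ?thesis unfolding gauss_sinh_mellin_crit by simp
qed

text \<open>Mellin inversion on \<open>Re s = 1 / 2\<close>, as Fourier inversion for the bounded
  function \<open>exp (u / 2) * gauss_sinh z (exp u)\<close>.\<close>

lemma gauss_sinh_inversion:
  "gauss_sinh z (exp v) * exp (1 / 2 * of_real v)
     = 1 / (2 * of_real pi) * (\<integral>t. gauss_sinh_mellin z (crit t) * exp (- \<i> * of_real (t * v)) \<partial>lborel)"
proof -
  let ?f = "\<lambda>u. gauss_sinh z (exp u) * exp (1 / 2 * of_real u)"
  obtain B where B: "\<And>u. norm (?f u) \<le> B" using norm_gauss_sinh_le by blast
  have eq: "(\<integral>u. ?f u * exp (\<i> * of_real (t * u)) \<partial>lborel) = gauss_sinh_mellin z (crit t)" for t
  proof -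
    have "?f u * exp (\<i> * of_real (t * u)) = gauss_sinh z (exp u) * exp (crit t * of_real u)" for u
    proof -
      have "exp (crit t * of_real u) = exp (1 / 2 * of_real u) * exp (\<i> * of_real (t * u))"
        by (simp add: crit_def ring_distribs mult_ac flip: exp_add)
      then show ?thesis by (simp only: mult_ac)
    qed
    then show ?thesis
      by (simp only:) (rule has_bochner_integral_integral_eq[OF mellin_gauss_sinh], simp)
  qed
  have int: "integrable lborel ?f"
    using mellin_gauss_sinh[of "1 / 2" z] by (simp add: has_bochner_integral_iff)
  have intF: "integrable lborel (\<lambda>t. \<integral>u. ?f u * exp (\<i> * of_real (t * u)) \<partial>lborel)"
    unfolding eq by (rule gauss_sinh_mellin_crit_integrable)
  show ?thesis
    using fourier_inversion[OF gauss_sinh_continuous int B intF, of v] unfolding eq .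
qed

text \<open>The exponent \<open>crit (- t) = 1 - s\<close> is the one that Parseval's formula pairs
  with \<open>s = crit t\<close>; by the reflected evaluation it carries zeta at \<open>s\<close>
  itself.\<close>

definition bose_mellin :: "real \<Rightarrow> complex" where
  "bose_mellin t = (\<integral>u. of_real (bose (exp u)) * exp (crit (- t) * of_real u) \<partial>lborel)"

lemma bose_mellin_eq:
  "bose_mellin t = Gamma (crit t / 2) * Gamma (1 - crit t / 2) / (2 * of_real pi) * (zeta_reg (crit t) / (crit t - 1))"
  using has_bochner_integral_integral_eq[OF mellin_bose_reflected[of "crit t"]]
  by (simp add: bose_mellin_def one_minus_crit)

lemma bose_crit_integrable: "integrable lborel (\<lambda>u. of_real (bose (exp u)) * exp (crit t * of_real u))"
  using mellin_bose[of "crit t"] by (simp add: has_bochner_integral_iff)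

lemma bose_half_integrable: "integrable lborel (\<lambda>u. bose (exp u) * exp (u / 2))"
proof -
  have "of_real (bose (exp u)) * exp (crit 0 * of_real u) = complex_of_real (bose (exp u) * exp (u / 2))" for u
    by (simp add: crit_def exp_of_real[symmetric])
  then show ?thesis
    using bose_crit_integrable[of 0] by (simp only: complex_of_real_integrable_eq)
qed

lemma measurable_bose_mellin [measurable]: "bose_mellin \<in> borel_measurable borel"
  unfolding bose_mellin_def crit_def by measurable

text \<open>Uniform in \<open>t\<close>: this takes the place of a growth estimate for zeta on the
  critical line.\<close>

lemma bose_mellin_bounded: "norm (bose_mellin t) \<le> (\<integral>u. norm (bose (exp u) * exp (u / 2)) \<partial>lborel)"
proof -
  have "norm (bose_mellin t) \<le> (\<integral>u. norm (of_real (bose (exp u)) * exp (crit (- t) * of_real u)) \<partial>lborel)"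
    unfolding bose_mellin_def by (rule integral_norm_bound)
  also have "(\<lambda>u. norm (of_real (bose (exp u)) * exp (crit (- t) * of_real u))) = (\<lambda>u. norm (bose (exp u) * exp (u / 2)))"
    by (simp add: norm_mult fun_eq_iff abs_mult)
  finally show ?thesis .
qed

text \<open>The inversion formula at \<open>v = u + ln b\<close> is inserted for the Gaussian
  factor. Fubini applies because the norm of the double integrand is an integrable function of
  \<open>t\<close> times one of \<open>u\<close>.\<close>

lemma gauss_sinh_bose_parseval:
  assumes "b > 0"
  shows "integrable lborel (\<lambda>u. gauss_sinh z (b * exp u) * of_real (bose (exp u)) * of_real (exp u))"
    and "of_real (sqrt b) * (\<integral>u. gauss_sinh z (b * exp u) * of_real (bose (exp u)) * of_real (exp u) \<partial>lborel)
      = 1 / (2 * of_real pi) * (\<integral>t. gauss_sinh_mellin z (crit t) * exp (- \<i> * of_real (t * ln b)) * bose_mellin t \<partial>lborel)"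
proof -
  let ?G = "\<lambda>u. gauss_sinh z (exp u) * exp (1 / 2 * of_real u)"
  let ?M = "\<lambda>t. gauss_sinh_mellin z (crit t)"
  let ?\<beta> = "\<lambda>u. complex_of_real (bose (exp u) * exp (u / 2))"
  have int_M: "integrable lborel ?M" by (rule gauss_sinh_mellin_crit_integrable)
  have [measurable]: "?M \<in> borel_measurable borel" using int_M by simp
  have int_\<beta>: "integrable lborel ?\<beta>" using bose_half_integrable by (simp only: complex_of_real_integrable_eq)
  have [measurable]: "?G \<in> borel_measurable borel"
    by (rule borel_measurable_continuous_onI[OF gauss_sinh_continuous])
  obtain B where B: "\<And>u. norm (?G u) \<le> B" using norm_gauss_sinh_le by blast
  \<comment> \<open>The measure factor \<open>exp u\<close> is split evenly: one half weights
    \<open>bose\<close>, the other together with \<open>sqrt b\<close> is the weight of the shifted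
    Gaussian factor.\<close>
  have prod_eq: "of_real (sqrt b) * (gauss_sinh z (b * exp u) * of_real (bose (exp u)) * of_real (exp u))
      = ?G (u + ln b) * ?\<beta> u" for u
  proof -
    have "exp ((u + ln b) / 2) = exp (u / 2) * sqrt b"
      using assms by (simp add: add_divide_distrib exp_add powr_half_sqrt[symmetric] powr_def)
    moreover have "exp (1 / 2 * complex_of_real (u + ln b)) = of_real (exp ((u + ln b) / 2))"
      by (simp add: exp_of_real[symmetric])
    ultimately have e1: "exp (1 / 2 * complex_of_real (u + ln b)) = of_real (exp (u / 2) * sqrt b)" by (simp only:)
    have e2: "exp (u + ln b) = b * exp u" using assms by (simp add: exp_add)
    have e3: "complex_of_real (exp u) = of_real (exp (u / 2)) * of_real (exp (u / 2))"
      by (simp flip: of_real_mult exp_add)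
    show ?thesis unfolding e1 e2 e3 of_real_mult by (simp only: mult_ac)
  qed
  have int_prod: "integrable lborel (\<lambda>u. ?G (u + ln b) * ?\<beta> u)"
  proof (rule Bochner_Integration.integrable_bound)
    show "integrable lborel (\<lambda>u. B * norm (?\<beta> u))" using int_\<beta> by (intro integrable_mult_right integrable_norm)
    have "B \<ge> 0" using B[of 0] norm_ge_zero order_trans by blast
    then show "AE u in lborel. norm (?G (u + ln b) * ?\<beta> u) \<le> norm (B * norm (?\<beta> u))"
    proof (intro AE_I2)
      fix u
      have "norm (?G (u + ln b)) * norm (?\<beta> u) \<le> B * norm (?\<beta> u)"
        using B[of "u + ln b"] by (rule mult_right_mono) simp
      also have "\<dots> = norm (B * norm (?\<beta> u))" using \<open>B \<ge> 0\<close> by (simp add: abs_mult)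
      finally show "norm (?G (u + ln b) * ?\<beta> u) \<le> norm (B * norm (?\<beta> u))"
        by (simp only: norm_mult)
    qed
  qed measurable
  then have "integrable lborel (\<lambda>u. 1 / of_real (sqrt b) * (of_real (sqrt b) * (gauss_sinh z (b * exp u) * of_real (bose (exp u)) * of_real (exp u))))"
    unfolding prod_eq by (rule integrable_mult_right)
  then show "integrable lborel (\<lambda>u. gauss_sinh z (b * exp u) * of_real (bose (exp u)) * of_real (exp u))"
    using assms by simp
  let ?h = "\<lambda>u t. ?M t * exp (- \<i> * of_real (t * (u + ln b))) * ?\<beta> u"
  have int_h: "integrable (lborel \<Otimes>\<^sub>M lborel) (\<lambda>(u, t). ?h u t)"
  proof (rule lborel_pair.Fubini_integrable)
    have "(\<lambda>u. \<integral>t. norm (case (u, t) of (u, t) \<Rightarrow> ?h u t) \<partial>lborel) = (\<lambda>u. (\<integral>t. norm (?M t) \<partial>lborel) * norm (?\<beta> u))"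
      by (simp add: norm_mult)
    then show "integrable lborel (\<lambda>u. \<integral>t. norm (case (u, t) of (u, t) \<Rightarrow> ?h u t) \<partial>lborel)"
      using integrable_norm[OF int_\<beta>] by (simp only:) (intro integrable_mult_right)
    show "AE u in lborel. integrable lborel (\<lambda>t. case (u, t) of (u, t) \<Rightarrow> ?h u t)"
    proof (rule AE_I2)
      fix u
      show "integrable lborel (\<lambda>t. case (u, t) of (u, t) \<Rightarrow> ?h u t)"
        by (rule Bochner_Integration.integrable_bound[where f = "\<lambda>t. norm (?M t) * norm (?\<beta> u)"])
           (use int_M in \<open>auto simp: norm_mult\<close>)
    qed
  qed measurable
  have "of_real (sqrt b) * (\<integral>u. gauss_sinh z (b * exp u) * of_real (bose (exp u)) * of_real (exp u) \<partial>lborel)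
     = (\<integral>u. ?G (u + ln b) * ?\<beta> u \<partial>lborel)"
    unfolding prod_eq[symmetric] by simp
  also have "\<dots> = (\<integral>u. 1 / (2 * of_real pi) * (\<integral>t. ?h u t \<partial>lborel) \<partial>lborel)"
    unfolding gauss_sinh_inversion by (simp only: integral_mult_left_zero) (simp only: mult.assoc)
  also have "\<dots> = 1 / (2 * of_real pi) * (\<integral>u. (\<integral>t. ?h u t \<partial>lborel) \<partial>lborel)" by simp
  also have "(\<integral>u. (\<integral>t. ?h u t \<partial>lborel) \<partial>lborel) = (\<integral>t. (\<integral>u. ?h u t \<partial>lborel) \<partial>lborel)"
    by (rule lborel_pair.Fubini_integral[OF int_h, symmetric])
  also have "(\<lambda>t. \<integral>u. ?h u t \<partial>lborel) = (\<lambda>t. ?M t * exp (- \<i> * of_real (t * ln b)) * bose_mellin t)"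
  proof
    fix t
    have "?h u t = ?M t * exp (- \<i> * of_real (t * ln b)) * (of_real (bose (exp u)) * exp (crit (- t) * of_real u))" for u
    proof -
      have "exp (crit (- t) * of_real u) = exp (of_real (u / 2)) * exp (- \<i> * of_real (t * u))"
        by (simp add: crit_def ring_distribs mult_ac flip: exp_add)
      moreover have "exp (- \<i> * of_real (t * (u + ln b))) = exp (- \<i> * of_real (t * ln b)) * exp (- \<i> * of_real (t * u))"
      proof -
        have "- \<i> * of_real (t * (u + ln b)) = - \<i> * of_real (t * ln b) + - \<i> * complex_of_real (t * u)"
          by (simp add: algebra_simps)
        then show ?thesis by (simp only: exp_add)
      qed
      ultimately show ?thesis by (simp add: exp_of_real mult_ac del: of_real_divide)
    qed
    then show "(\<integral>u. ?h u t \<partial>lborel) = ?M t * exp (- \<i> * of_real (t * ln b)) * bose_mellin t"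
      by (simp only: bose_mellin_def integral_mult_right_zero)
  qed
  finally show "of_real (sqrt b) * (\<integral>u. gauss_sinh z (b * exp u) * of_real (bose (exp u)) * of_real (exp u) \<partial>lborel)
      = 1 / (2 * of_real pi) * (\<integral>t. ?M t * exp (- \<i> * of_real (t * ln b)) * bose_mellin t \<partial>lborel)" .
qed

section \<open>The integral over the critical line\<close>

text \<open>Passes from the whole critical line to the half-line of the Xi integral, in which
  \<open>Delta\<close> combines the values at \<open>s\<close> and \<open>1 - s\<close>.\<close>

lemma integral_fold:
  fixes f :: "real \<Rightarrow> complex"
  assumes "integrable lborel f"
  shows "((\<lambda>t. f t + f (- t)) has_integral integral\<^sup>L lborel f) {0<..}"
proof -
  have [measurable]: "f \<in> borel_measurable borel" using assms by simp
  have pos: "integrable lborel (\<lambda>t. indicator {0<..} t *\<^sub>R f t)" and neg: "integrable lborel (\<lambda>t. indicator {..<0} t *\<^sub>R f t)"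
    using assms by (auto intro: integrable_mult_indicator)
  have "has_bochner_integral lborel (\<lambda>t. indicator {..<0} (- t) *\<^sub>R f (- t)) (\<integral>t. indicator {..<0} t *\<^sub>R f t \<partial>lborel)"
    by (rule integral_reflect[OF has_bochner_integral_integrable[OF neg]])
  also have "(\<lambda>t. indicator {..<0} (- t) *\<^sub>R f (- t)) = (\<lambda>t. indicator {0<..} t *\<^sub>R f (- t))"
    by (auto simp: indicator_def fun_eq_iff)
  finally have neg': "has_bochner_integral lborel (\<lambda>t. indicator {0<..} t *\<^sub>R f (- t)) (\<integral>t. indicator {..<0} t *\<^sub>R f t \<partial>lborel)" .
  have int: "set_integrable lborel {0<..} (\<lambda>t. f t + f (- t))"
    unfolding set_integrable_def scaleR_add_right using pos neg' by (intro Bochner_Integration.integrable_add) (auto simp: has_bochner_integral_iff)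
  have "(LINT t:{0<..}|lborel. f t + f (- t)) = (\<integral>t. indicator {0<..} t *\<^sub>R f t \<partial>lborel) + (\<integral>t. indicator {..<0} t *\<^sub>R f t \<partial>lborel)"
    unfolding set_lebesgue_integral_def scaleR_add_right using pos neg' by (simp add: has_bochner_integral_iff)
  also have "\<dots> = (\<integral>t. indicator {0<..} t *\<^sub>R f t + indicator {..<0} t *\<^sub>R f t \<partial>lborel)"
    using pos neg by simp
  also have "\<dots> = integral\<^sup>L lborel f"
  proof (rule integral_cong_AE)
    show "AE t in lborel. indicator {0<..} t *\<^sub>R f t + indicator {..<0} t *\<^sub>R f t = f t"
      using AE_lborel_singleton[of "0::real"] by eventually_elim (auto simp: indicator_def)
  qed measurable
  finally show ?thesis
    using set_borel_integral_eq_integral[OF int] by (simp add: has_integral_iff)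
qed

lemma sinh_integrand_integral:
  fixes z :: complex
  assumes "b > 0"
  defines "B \<equiv> (\<integral>u. gauss_sinh z (b * exp u) * of_real (bose (exp u)) * of_real (exp u) \<partial>lborel)"
  shows "sinh_integrand b z integrable_on {0<..}"
    and "erfi (z / 2) - 4 * integral {0<..} (sinh_integrand b z) = - 4 * B"
proof -
  have eq: "of_real (exp u) * sinh_integrand b z (exp u) =
      gauss_sinh z (b * exp u) * of_real (bose (exp u)) * of_real (exp u)
      + 1 / (2 * of_real pi) * (gauss_sinh z (b * exp u) * exp (0 * of_real u))" for u
  proof -
    define x where "x = exp u"
    have x: "x > 0" by (simp add: x_def)
    have s: "sinh_integrand b z x = gauss_sinh z (b * x) * of_real (1 / (exp (2 * pi * x) - 1))"
      by (simp add: sinh_integrand_def gauss_sinh_def power_mult_distrib mult_ac)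
    have "x * (1 / (exp (2 * pi * x) - 1)) = bose x * x + 1 / (2 * pi)"
      using x by (simp add: bose_def algebra_simps)
    then have "complex_of_real x * of_real (1 / (exp (2 * pi * x) - 1)) = of_real (bose x * x + 1 / (2 * pi))"
      by (metis of_real_mult)
    then have "of_real x * sinh_integrand b z x = gauss_sinh z (b * x) * of_real (bose x * x + 1 / (2 * pi))"
      unfolding s by (metis mult.left_commute)
    then show ?thesis by (simp add: x_def ring_distribs)
  qed
  have I1: "has_bochner_integral lborel (\<lambda>u. gauss_sinh z (b * exp u) * of_real (bose (exp u)) * of_real (exp u)) B"
    unfolding B_def by (rule has_bochner_integral_integrable[OF gauss_sinh_bose_parseval(1)[OF assms(1)]])
  \<comment> \<open>The exponent 0 means integration against the scaling-invariant measure
    \<open>dx / x\<close>, so \<open>b\<close> drops out and \<open>erfi\<close> appears without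
    it.\<close>
  have I2: "has_bochner_integral lborel (\<lambda>u. 1 / (2 * of_real pi) * (gauss_sinh z (b * exp u) * exp (0 * of_real u)))
     (1 / (2 * of_real pi) * (of_real b powr (- 0) * gauss_sinh_mellin z 0))"
    by (intro has_bochner_integral_mult_right mellin_scale mellin_gauss_sinh assms(1)) simp
  have I: "has_bochner_integral lborel (\<lambda>u. of_real (exp u) * sinh_integrand b z (exp u)) (B + erfi (z / 2) / 4)"
  proof -
    have "1 / (2 * of_real pi) * (of_real b powr (- 0) * gauss_sinh_mellin z 0) = erfi (z / 2) / 4"
      using assms(1) by (simp add: gauss_sinh_mellin_0)
    then show ?thesis unfolding eq using has_bochner_integral_add[OF I1 I2] by (simp only:)
  qed
  then have int: "integrable lborel (\<lambda>u. of_real (exp u) * sinh_integrand b z (exp u))"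
    by (simp add: has_bochner_integral_iff)
  show "sinh_integrand b z integrable_on {0<..}"
    using absolutely_integrable_exp_substitution(1)[OF int] by (rule set_lebesgue_integral_eq_integral(1))
  have "integral {0<..} (sinh_integrand b z) = B + erfi (z / 2) / 4"
    unfolding absolutely_integrable_exp_substitution(2)[OF int] by (rule has_bochner_integral_integral_eq[OF I])
  then show "erfi (z / 2) - 4 * integral {0<..} (sinh_integrand b z) = - 4 * B" by simp
qed

text \<open>One of the two summands of \<open>Delta\<close>. The argument \<open>1 - s\<close> is
  chosen because the Kummer parameter of \<open>omega\<close> is then \<open>(1 + s) / 2\<close>, as
  in \<open>gauss_sinh_mellin\<close>.\<close>

definition crit_integrand :: "real \<Rightarrow> complex \<Rightarrow> real \<Rightarrow> complex" where
  "crit_integrand a z t = Gamma ((crit t - 1) / 2) * Gamma (- crit t / 2) * xi_half (crit t) * omega a z (1 - crit t)"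

text \<open>The factors \<open>s / 2\<close> and \<open>s - 1\<close> of xi raise the Gamma
  arguments by 1, up to sign and halves: \<open>(s - 1) / 2\<close> becomes
  \<open>(1 + s) / 2\<close>, the Gamma value in \<open>kummer_line\<close>, and
  \<open>- s / 2\<close> becomes \<open>1 - s / 2\<close>, the one in
  \<open>bose_mellin\<close>.\<close>

lemma crit_integrand_eq:
  assumes "a > 0"
  shows "crit_integrand a z t = - 4 * of_real pi * exp (- (z^2) / 8) *
    (of_real pi powr (- crit t / 2) * kummer_line (z^2 / 4) t * exp (\<i> * of_real (t * ln a)) * bose_mellin t)"
proof -
  define s where "s = crit t"
  have s1: "s \<noteq> 1" "s \<noteq> 0" using Re_crit[of t] by (auto simp: s_def simp del: Re_crit)
  have not_nonpos: "w \<notin> \<int>\<^sub>\<le>\<^sub>0" if "Re w = - 1 / 4" for w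
  proof
    assume "w \<in> \<int>\<^sub>\<le>\<^sub>0"
    then obtain n where "w = of_int n" by (auto elim!: nonpos_Ints_cases)
    then have "of_int (4 * n) = (of_int (- 1) :: real)" using that by simp
    then have "4 * n = - 1" by (simp only: of_int_eq_iff)
    then show False by presburger
  qed
  have "Re ((s - 1) / 2) = - 1 / 4" "Re (- s / 2) = - 1 / 4" by (simp_all add: s_def)
  note G = Gamma_plus1[OF not_nonpos[OF this(1)]] Gamma_plus1[OF not_nonpos[OF this(2)]]
  have half: "(s - 1) / 2 + 1 = 3 / 4 + \<i> * of_real t / 2" "- s / 2 + 1 = 1 - s / 2"
    by (simp_all add: s_def crit_def field_simps)
  have om: "omega a z (1 - s) = exp (\<i> * of_real (t * ln a)) * exp (- (z^2) / 8) * kummer_1F1 (3 / 4 + \<i> * of_real t / 2) (3 / 2) (z^2 / 4)"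
  proof -
    have "of_real a powr (1 / 2 - (1 - s)) = exp (\<i> * of_real (t * ln a))"
      using assms by (simp add: powr_def s_def crit_def Ln_of_real mult_ac)
    moreover have "1 - (1 - s) / 2 = 3 / 4 + \<i> * of_real t / 2" by (simp add: s_def crit_def field_simps)
    ultimately show ?thesis by (simp add: omega_def)
  qed
  have xi: "xi_half s = of_real pi powr (- s / 2) * (s / 2 * Gamma (s / 2)) * ((s - 1) * (zeta_reg s / (s - 1)))"
    using s1 by (simp add: xi_half_def Gamma_half_plus1 s_def)
  define E P K g1 g2 g3 Z where "E = exp (\<i> * complex_of_real (t * ln a))" and "P = of_real pi powr (- s / 2)"
    and "K = kummer_1F1 (3 / 4 + \<i> * of_real t / 2) (3 / 2) (z^2 / 4)"
    and "g1 = Gamma ((s - 1) / 2)" and "g2 = Gamma (- s / 2)" and "g3 = Gamma (s / 2)" and "Z = zeta_reg s / (s - 1)"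
  have "crit_integrand a z t = g1 * g2 * (P * (s / 2 * g3) * ((s - 1) * Z)) * (E * exp (- (z^2) / 8) * K)"
    unfolding crit_integrand_def s_def[symmetric] om xi g1_def g2_def g3_def E_def P_def K_def Z_def ..
  moreover have "- 4 * of_real pi * exp (- (z^2) / 8) *
    (of_real pi powr (- s / 2) * kummer_line (z^2 / 4) t * exp (\<i> * of_real (t * ln a)) * bose_mellin t)
    = - 4 * of_real pi * exp (- (z^2) / 8) * (P * ((s - 1) / 2 * g1 * K) * E * (g3 * (- s / 2 * g2) / (2 * of_real pi) * Z))"
    unfolding kummer_line_def bose_mellin_eq s_def[symmetric] half[symmetric] G
    unfolding g1_def g2_def g3_def E_def P_def K_def Z_def half[symmetric] by (rule refl)
  moreover have "g1 * g2 * (P * (s / 2 * g3) * ((s - 1) * Z)) * (E * x * K)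
    = - 4 * p * x * (P * ((s - 1) / 2 * g1 * K) * E * (g3 * (- s / 2 * g2) / (2 * p) * Z))" if "p \<noteq> 0" for p x
    using that by (simp add: field_simps)
  moreover have "complex_of_real pi \<noteq> 0" by simp
  ultimately show ?thesis unfolding s_def[symmetric] by (simp only:)
qed

lemma crit_integrand_integrable:
  assumes "a > 0"
  shows "integrable lborel (crit_integrand a z)"
proof -
  have [measurable]: "kummer_line (z^2 / 4) \<in> borel_measurable borel"
    using kummer_line_integrable by simp
  let ?B = "\<integral>u. norm (bose (exp u) * exp (u / 2)) \<partial>lborel"
  let ?V = "\<lambda>t. of_real pi powr (- crit t / 2) * kummer_line (z^2 / 4) t * exp (\<i> * of_real (t * ln a)) * bose_mellin t"
  have meas: "?V \<in> borel_measurable borel"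
    by (intro borel_measurable_times measurable_crit_exp) measurable
  have "integrable lborel ?V"
  proof (rule Bochner_Integration.integrable_bound)
    show "integrable lborel (\<lambda>t. norm (kummer_line (z^2 / 4) t) * ?B)"
      by (intro integrable_mult_left integrable_norm kummer_line_integrable)
    show "AE t in lborel. norm (?V t) \<le> norm (norm (kummer_line (z^2 / 4) t) * ?B)"
    proof (rule AE_I2)
      fix t
      have "norm (?V t) = (norm (of_real pi powr (- crit t / 2)) * norm (kummer_line (z^2 / 4) t)) * norm (bose_mellin t)"
        by (simp only: norm_mult) simp
      also have "\<dots> \<le> (1 * norm (kummer_line (z^2 / 4) t)) * ?B"
        by (intro mult_mono pi_powr_crit_bounded bose_mellin_bounded) auto
      also have "\<dots> \<le> norm (norm (kummer_line (z^2 / 4) t) * ?B)" by simp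
      finally show "norm (?V t) \<le> norm (norm (kummer_line (z^2 / 4) t) * ?B)" .
    qed
  qed (use meas in simp)
  then show ?thesis unfolding crit_integrand_eq[OF assms, abs_def] by (rule integrable_mult_right)
qed

text \<open>Under the exchange of \<open>s\<close> and \<open>1 - s\<close> the two Gamma factors
  change places and xi is invariant, so both summands of \<open>Delta\<close> come from one
  function.\<close>

lemma Xi_integrand_eq:
  "Xi_integrand a z t = crit_integrand a z (t / 2) + crit_integrand a z (- (t / 2))"
proof -
  define s where "s = crit (t / 2)"
  have s': "crit (- (t / 2)) = 1 - s" by (simp add: s_def one_minus_crit)
  have "(- 1 + \<i> * of_real t) / 4 = (s - 1) / 2" "(- 1 - \<i> * of_real t) / 4 = - s / 2"
    "(1 + \<i> * of_real t) / 2 = s" "1 / 2 + \<i> * (of_real t / 2) = s"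
    by (simp_all add: s_def crit_def field_simps)
  moreover have "riemann_xi s = xi_half s" by (rule riemann_xi_strip) (simp_all add: s_def)
  ultimately have "Xi_integrand a z t = Gamma ((s - 1) / 2) * Gamma (- s / 2) * xi_half s * (omega a z s + omega a z (1 - s))"
    by (simp only: Xi_integrand_def riemann_Xi_def Delta_def)
  moreover have "crit_integrand a z (- (t / 2)) = Gamma (- s / 2) * Gamma ((s - 1) / 2) * xi_half s * omega a z s"
  proof -
    have "xi_half (1 - s) = xi_half s" by (rule xi_half_reflect) (simp_all add: s_def)
    moreover have "(1 - s - 1) / 2 = - s / 2" "- (1 - s) / 2 = (s - 1) / 2" "1 - (1 - s) = s" by simp_all
    ultimately show ?thesis unfolding crit_integrand_def s' by (simp only:)
  qed
  ultimately show ?thesis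
    by (simp add: crit_integrand_def s_def[symmetric] ring_distribs mult_ac)
qed

lemma Xi_integrand_has_integral:
  assumes "a > 0"
  shows "(Xi_integrand a z has_integral 2 * integral\<^sup>L lborel (crit_integrand a z)) {0<..}"
proof -
  have "has_bochner_integral lborel (\<lambda>t. crit_integrand a z (0 + 1 / 2 * t)) (integral\<^sup>L lborel (crit_integrand a z) /\<^sub>R \<bar>1 / 2\<bar>)"
    using has_bochner_integral_integrable[OF crit_integrand_integrable[OF assms, of z]]
    by (subst (asm) lborel_has_bochner_integral_real_affine_iff[where c = "1 / 2" and t = 0]) simp_all
  then have "has_bochner_integral lborel (\<lambda>t. crit_integrand a z (t / 2)) (2 * integral\<^sup>L lborel (crit_integrand a z))"
    by (simp add: scaleR_conv_of_real)
  then have "integrable lborel (\<lambda>t. crit_integrand a z (t / 2))"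
    and eq: "(\<integral>t. crit_integrand a z (t / 2) \<partial>lborel) = 2 * integral\<^sup>L lborel (crit_integrand a z)"
    by (simp_all add: has_bochner_integral_iff)
  from integral_fold[OF this(1)] show ?thesis
    unfolding eq Xi_integrand_eq[abs_def] by simp
qed

text \<open>The oscillating factor in Parseval's formula has frequency
  \<open>- ln b = ln (1 / b)\<close>, which is why the Xi integral carries the inverse scale. The
  \<open>8 * pi^2\<close> collects the \<open>- 4 * pi\<close> of \<open>crit_integrand_eq\<close>
  and the factor 2 from rescaling \<open>t\<close>.\<close>

lemma sinh_side_eq_Xi:
  assumes "b > 0"
  shows "of_real (sqrt b) * exp (- (z^2) / 8) * (erfi (z / 2) - 4 * integral {0<..} (sinh_integrand b z))
    = z / (8 * of_real pi ^ 2) * integral {0<..} (Xi_integrand (1 / b) z)"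
proof -
  let ?B = "\<integral>u. gauss_sinh z (b * exp u) * of_real (bose (exp u)) * of_real (exp u) \<partial>lborel"
  let ?V = "\<lambda>t. of_real pi powr (- crit t / 2) * kummer_line (z^2 / 4) t * exp (\<i> * of_real (t * ln (1 / b))) * bose_mellin t"
  have "gauss_sinh_mellin z (crit t) * exp (- \<i> * of_real (t * ln b)) * bose_mellin t = z / 2 * ?V t" for t
    using assms by (simp add: gauss_sinh_mellin_crit ln_div)
  then have "of_real (sqrt b) * ?B = 1 / (2 * of_real pi) * (\<integral>t. z / 2 * ?V t \<partial>lborel)"
    using gauss_sinh_bose_parseval(2)[OF assms, of z] by (simp only:)
  then have B: "of_real (sqrt b) * ?B = z / (4 * of_real pi) * (\<integral>t. ?V t \<partial>lborel)" by simp
  have W: "integral\<^sup>L lborel (crit_integrand (1 / b) z) = - 4 * of_real pi * exp (- (z^2) / 8) * (\<integral>t. ?V t \<partial>lborel)"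
  proof -
    have "crit_integrand (1 / b) z = (\<lambda>t. - 4 * of_real pi * exp (- (z^2) / 8) * ?V t)"
      by (intro ext crit_integrand_eq) (use assms in simp)
    then show ?thesis by (simp only: integral_mult_right_zero)
  qed
  have "of_real (sqrt b) * exp (- (z^2) / 8) * (erfi (z / 2) - 4 * integral {0<..} (sinh_integrand b z))
     = - 4 * exp (- (z^2) / 8) * (of_real (sqrt b) * ?B)"
    unfolding sinh_integrand_integral(2)[OF assms] by simp
  also have "\<dots> = z / (8 * of_real pi ^ 2) * (2 * integral\<^sup>L lborel (crit_integrand (1 / b) z))"
    unfolding B W by (simp add: power2_eq_square)
  also have "2 * integral\<^sup>L lborel (crit_integrand (1 / b) z) = integral {0<..} (Xi_integrand (1 / b) z)"
    using Xi_integrand_has_integral[of "1 / b" z] assms by (simp add: integral_unique)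
  finally show ?thesis .
qed

text \<open>Inverting \<open>a\<close> negates the exponent \<open>1 / 2 - s\<close>, which amounts
  to replacing \<open>s\<close> by \<open>1 - s\<close>; Kummer's transformation does the same to
  the hypergeometric factor, and its exponential turns \<open>exp (z^2 / 8)\<close> into
  \<open>exp (- (z^2) / 8)\<close>.\<close>

lemma omega_ii:
  assumes "a > 0"
  shows "omega (1 / a) (\<i> * z) s = omega a z (1 - s)"
proof -
  let ?w = "z^2 / 4"
  have "of_real (1 / a) powr (1 / 2 - s) = complex_of_real a powr (1 / 2 - (1 - s))"
  proof -
    have "Ln (complex_of_real (1 / a)) = - Ln (of_real a)"
      using assms by (simp add: Ln_of_real ln_div del: of_real_divide)
    then show ?thesis using assms by (simp add: powr_def algebra_simps del: of_real_divide)
  qed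
  moreover have "kummer_1F1 (1 - s / 2) (3 / 2) (- ?w) = exp (- ?w) * kummer_1F1 (1 - (1 - s) / 2) (3 / 2) ?w"
  proof -
    have "3 / 2 - (1 - (1 - s) / 2) = 1 - s / 2" by (simp add: field_simps)
    then show ?thesis using kummer_transformation[of "1 - (1 - s) / 2" ?w] by (simp only:)
  qed
  moreover have "exp (z^2 / 8) * exp (- ?w) = exp (- (z^2) / 8)" by (simp flip: exp_add)
  ultimately show ?thesis
    by (simp add: omega_def power_mult_distrib mult.assoc[symmetric])
qed

lemma Xi_integrand_ii:
  assumes "a > 0"
  shows "Xi_integrand (1 / a) (\<i> * z) = Xi_integrand a z"
  by (simp add: Xi_integrand_def Delta_def omega_ii[OF assms] add.commute fun_eq_iff)

lemma sinh_integrand_ii: "sinh_integrand a (\<i> * z) x = \<i> * sin_integrand a z x"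
proof -
  have "sinh (\<i> * w) = \<i> * sin w" for w :: complex
    by (simp add: sinh_def sin_exp_eq' scaleR_conv_of_real algebra_simps)
  then have "sinh (of_real (sqrt pi * a * x) * (\<i> * z)) = \<i> * sin (of_real (sqrt pi * a * x) * z)"
    by (metis mult.left_commute)
  then show ?thesis by (simp add: sinh_integrand_def sin_integrand_def)
qed

theorem theorem1p1:
  fixes z :: complex and \<alpha> \<beta> :: real
  assumes "\<alpha> > 0" and "\<beta> > 0" and "\<alpha> * \<beta> = 1"
  shows "sin_integrand \<alpha> z integrable_on {0<..} \<and>
    sinh_integrand \<beta> z integrable_on {0<..} \<and>
    Xi_integrand \<alpha> z integrable_on {0<..} \<and>
    of_real (sqrt \<alpha>) * exp (z ^ 2 / 8)
        * (erf (z / 2) - 4 * integral {0<..} (sin_integrand \<alpha> z))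
      = of_real (sqrt \<beta>) * exp (- (z ^ 2) / 8)
        * (erfi (z / 2) - 4 * integral {0<..} (sinh_integrand \<beta> z)) \<and>
    of_real (sqrt \<beta>) * exp (- (z ^ 2) / 8)
        * (erfi (z / 2) - 4 * integral {0<..} (sinh_integrand \<beta> z))
      = z / (8 * of_real pi ^ 2) * integral {0<..} (Xi_integrand \<alpha> z)"
proof -
  have inv: "1 / \<beta> = \<alpha>" using assms by (simp add: field_simps)
  have sin_eq: "sin_integrand \<alpha> z x = - \<i> * sinh_integrand \<alpha> (\<i> * z) x" for x
    by (simp add: sinh_integrand_ii)
  have sinh_int: "sinh_integrand \<alpha> (\<i> * z) integrable_on {0<..}"
    by (rule sinh_integrand_integral(1)[OF assms(1)])
  have sin_int: "sin_integrand \<alpha> z integrable_on {0<..}"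
    unfolding sin_eq[abs_def] by (rule integrable_on_mult_right[OF sinh_int])
  have sinh_sin: "integral {0<..} (sinh_integrand \<alpha> (\<i> * z)) = \<i> * integral {0<..} (sin_integrand \<alpha> z)"
    unfolding sinh_integrand_ii[abs_def] by (rule integral_mult_right)
  have sinh_Xi: "of_real (sqrt \<beta>) * exp (- (z ^ 2) / 8) * (erfi (z / 2) - 4 * integral {0<..} (sinh_integrand \<beta> z))
      = z / (8 * of_real pi ^ 2) * integral {0<..} (Xi_integrand \<alpha> z)"
    using sinh_side_eq_Xi[OF assms(2), of z] by (simp only: inv)
  \<comment> \<open>The sinh identity at scale \<open>\<alpha>\<close> and argument
    \<open>\<i> * z\<close>; every side then shows a common factor \<open>\<i>\<close>, which is
    cancelled.\<close>
  have "of_real (sqrt \<alpha>) * exp (- ((\<i> * z) ^ 2) / 8) * (erfi (\<i> * (z / 2)) - 4 * integral {0<..} (sinh_integrand \<alpha> (\<i> * z)))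
     = (\<i> * z) / (8 * of_real pi ^ 2) * integral {0<..} (Xi_integrand \<alpha> z)"
    using sinh_side_eq_Xi[OF assms(1), of "\<i> * z"] by (simp only: Xi_integrand_ii[OF assms(1)] times_divide_eq_right)
  then have "\<i> * (of_real (sqrt \<alpha>) * exp (z ^ 2 / 8) * (erf (z / 2) - 4 * integral {0<..} (sin_integrand \<alpha> z)))
     = \<i> * (z / (8 * of_real pi ^ 2) * integral {0<..} (Xi_integrand \<alpha> z))"
    unfolding erfi_ii sinh_sin by (simp add: power_mult_distrib algebra_simps)
  then have sin_Xi: "of_real (sqrt \<alpha>) * exp (z ^ 2 / 8) * (erf (z / 2) - 4 * integral {0<..} (sin_integrand \<alpha> z))
     = z / (8 * of_real pi ^ 2) * integral {0<..} (Xi_integrand \<alpha> z)"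
    by (subst (asm) mult_left_cancel) auto
  show ?thesis
    using sin_int sinh_integrand_integral(1)[OF assms(2)] Xi_integrand_has_integral[OF assms(1)] sin_Xi sinh_Xi
    by (auto simp: integrable_on_def)
qed

end
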